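(* As power series (Laurent series where negative powers appear) in $q$, $|q|<1$: \begin{align*} &\sum_{n\ge0}N^{0}(0,2;2n+1)q^n=-qg(-q^2;q^4)+\frac{J_{2}^8J_{8}^2}{J_{1}^4J_{4}^5},\qquad \sum_{n\ge0}N^{0}(0,2;4n+1)q^n=\frac{J_{2}^9}{J_{1}^6J_{4}^2},\\ &\sum_{n\ge0}N^{0}(0,2;4n+3)q^n=-g(-q;q^2)+4\frac{J_{4}^6}{J_{1}^2J_{2}^3},\qquad \sum_{n\ge0}N^{0}(1,2;2n)q^n=-1+g(-1;q^4)+\frac{1}{2}\frac{J_{2}^6J_{4}}{J_{1}^4J_{8}^2},\\ &\sum_{n\ge0}N^{0}(1,2;4n)q^n=-1+g(-1;q^2)+\frac{1}{2}\frac{J_{2}^{15}}{J_{1}^8J_{4}^6},\qquad \sum_{n\ge0}N^{0}(1,2;4n+2)q^n=2\frac{J_{2}^3J_{4}^2}{J_{1}^4},\\ &\sum_{n\ge0}N^{0}(0,2;8n+1)q^n=\frac{J_{2}^{12}J_{4}}{J_{1}^{10}J_{8}^2}+8q\frac{J_{2}^2J_{4}^3J_{8}^2}{J_{1}^6},\\ &\sum_{n\ge0}N^{0}(0,2;8n+3)q^n=qg(-q^2;q^4)-\frac{J_{2}^8J_{8}^2}{J_{1}^4J_{4}^5}+4\frac{J_{2}^6J_{4}^5}{J_{1}^8J_{8}^2},\\ &\sum_{n\ge0}N^{0}(0,2;8n+5)q^n=2\left(\frac{J_{2}^{14}J_{8}^2}{J_{1}^{10}J_{4}^5}+2\frac{J_{4}^9}{J_{1}^6J_{8}^2}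 \right),\\ &\sum_{n\ge0}N^{0}(0,2;8n+7)q^n=-q^{-1}+q^{-1}g(-1;q^4)+\frac{1}{2}q^{-1}\frac{J_{2}^6J_{4}}{J_{1}^4J_{8}^2}+8\frac{J_{2}^8J_{8}^2}{J_{1}^8J_{4}},\\ &\sum_{n\ge0}N^{0}(1,2;8n)q^n=-1+g(-1;q)+\frac{1}{2}\frac{J_{2}^{22}}{J_{1}^{13}J_{4}^8}+8q\frac{J_{4}^8}{J_{1}^5J_{2}^2},\qquad \sum_{n\ge0}N^{0}(1,2;8n+2)q^n=2\frac{J_{2}^{16}}{J_{1}^{11}J_{4}^4},\\ &\sum_{n\ge0}N^{0}(1,2;8n+4)q^n=4\frac{J_{2}^{10}}{J_{1}^9},\qquad \sum_{n\ge0}N^{0}(1,2;8n+6)q^n=8\frac{J_{2}^4J_{4}^4}{J_{1}^7}. \end{align*}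
   Context: For $|q|<1$: $(a;q)_n=\prod_{k=0}^{n-1}(1-aq^k)$, $(a;q)_\infty=\prod_{k\ge0}(1-aq^k)$, $J_m=(q^m;q^m)_\infty$, and for $x$ not an integer power of $q$, \[g(x;q)=x^{-1}\Big(-1+\sum_{n=0}^{\infty}\frac{q^{n^2}}{(x;q)_{n+1}(q/x;q)_{n}}\Big)\] (expressions such as $g(-q^2;q^4)$ mean this function with $x=-q^2$ and $q$ replaced by $q^4$). An odd Durfee symbol of a positive integer $n$ consists of a nonnegative integer $D$ together with two (possibly empty) non-increasing sequences of odd positive integers $a_1\ge\cdots\ge a_s$ (top row) and $b_1\ge\cdots\ge b_t$ (bottom row), all entries at most $2D+1$, with $n=\sum a_i+\sum b_j+2D^2+2D+1$; its odd rank is $s-t$. $N^{0}(a,M;n)$ is the number of odd Durfee symbols of $n$ with odd rank congruent to $a$ modulo $M$, and $N^0(a,M;0)=0$. *)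

theory Defs
  imports "HOL-Analysis.Analysis" "HOL-Number_Theory.Cong"
begin

definition qpoch :: "complex \<Rightarrow> complex \<Rightarrow> nat \<Rightarrow> complex" where
  "qpoch a q n = (\<Prod>k<n. 1 - a * q ^ k)"

definition qpoch_inf :: "complex \<Rightarrow> complex \<Rightarrow> complex" where
  "qpoch_inf a q = (\<Prod>k. 1 - a * q ^ k)"

definition J :: "complex \<Rightarrow> nat \<Rightarrow> complex" where
  "J q m = qpoch_inf (q ^ m) (q ^ m)"

text \<open>Only meaningful for \<open>norm q < 1\<close> and \<open>x\<close> nonzero and not an integer power of \<open>q\<close>.\<close>

definition mock_g :: "complex \<Rightarrow> complex \<Rightarrow> complex" where
  "mock_g x q =
     inverse x * (- 1 + (\<Sum>n. q ^ (n\<^sup>2) / (qpoch x q (n + 1) * qpoch (q / x) q n)))"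

text \<open>A symbol is a triple \<open>(D, as, bs)\<close> with top row \<open>as\<close> and bottom row \<open>bs\<close>.\<close>

definition odd_durfee_row :: "nat \<Rightarrow> nat list \<Rightarrow> bool" where
  "odd_durfee_row D xs \<longleftrightarrow>
     sorted_wrt (\<ge>) xs \<and> (\<forall>x\<in>set xs. odd x \<and> x \<le> 2 * D + 1)"

definition odd_durfee_symbols :: "nat \<Rightarrow> (nat \<times> nat list \<times> nat list) set" where
  "odd_durfee_symbols n =
     {(D, as, bs). odd_durfee_row D as \<and> odd_durfee_row D bs \<and>
        n = sum_list as + sum_list bs + 2 * D\<^sup>2 + 2 * D + 1}"

definition odd_rank :: "nat \<times> nat list \<times> nat list \<Rightarrow> int" where
  "odd_rank S = (case S of (D, as, bs) \<Rightarrow> int (length as) - int (length bs))"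

definition N0 :: "int \<Rightarrow> int \<Rightarrow> nat \<Rightarrow> nat" where
  "N0 a M n = card {S \<in> odd_durfee_symbols n. [odd_rank S = a] (mod M)}"

lemma N0_zero: "N0 a M 0 = 0"
  by (simp add: N0_def odd_durfee_symbols_def)

lemma length_le_sum_list_odd:
  "\<forall>x\<in>set xs. odd (x::nat) \<Longrightarrow> length xs \<le> sum_list xs"
proof (induction xs)
  case (Cons x xs)
  then have "x \<ge> 1" by (auto elim: oddE)
  with Cons show ?case by auto
qed simp

lemma finite_odd_durfee_symbols: "finite (odd_durfee_symbols n)"
proof (rule finite_subset)
  let ?L = "{xs. set xs \<subseteq> {..n} \<and> length xs \<le> n}"
  show "odd_durfee_symbols n \<subseteq> {..n} \<times> ?L \<times> ?L"
  proof
    fix S assume "S \<in> odd_durfee_symbols n"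
    then obtain D as bs where S: "S = (D, as, bs)"
      and rows: "odd_durfee_row D as" "odd_durfee_row D bs"
      and n: "n = sum_list as + sum_list bs + 2 * D\<^sup>2 + 2 * D + 1"
      by (auto simp: odd_durfee_symbols_def)
    have "length as \<le> sum_list as" "length bs \<le> sum_list bs"
      using rows by (auto simp: odd_durfee_row_def intro!: length_le_sum_list_odd)
    moreover have "\<And>x. x \<in> set as \<Longrightarrow> x \<le> sum_list as" "\<And>x. x \<in> set bs \<Longrightarrow> x \<le> sum_list bs"
      by (simp_all add: member_le_sum_list)
    ultimately show "S \<in> {..n} \<times> ?L \<times> ?L"
      unfolding S using n by fastforce
  qed
  show "finite ({..n} \<times> ?L \<times> ?L)"
    by (intro finite_cartesian_product finite_lists_length_le) auto
qed

end

theory Submission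
  imports Defs "HOL-Complex_Analysis.Complex_Analysis"
begin

text \<open>
  The parity of the odd rank is determined by \<open>n\<close>, so every series is a section of the generating
  function \<open>q * mock_g q (q\<^sup>2)\<close> of all odd Durfee symbols. Multiplied by a theta function,
  \<open>mock_g x q\<close> becomes holomorphic in \<open>x\<close> on the punctured plane and satisfies a first-order
  \<open>q\<close>-difference equation. A combination of \<open>mock_g x q\<close> with two copies of base \<open>q ^ 4\<close>
  is \<open>q\<close>-periodic, hence constant by the maximum modulus principle; this expresses
  \<open>q * mock_g q (q\<^sup>2)\<close> through \<open>mock_g (- 1) (q ^ 8)\<close>, \<open>mock_g (- (q ^ 4)) (q ^ 8)\<close> and an eta
  quotient. The same principle gives the 2-dissection of \<open>1 / J q 1 ^ 2\<close>, from which that of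
  \<open>1 / J q 1 ^ 4\<close> follows. Splitting into even and odd parts three times yields all fourteen
  series.
\<close>

section \<open>Infinite q-Pochhammer symbols\<close>

text \<open>Put F(x) = 1 + x g(x;q). The functional equations give F(qx) = -q x^3 F(x) + 1 - q x^2,
  and the terms 1 - q x^2 are what obstructs a theta quotient. The shift x -> qx exchanges the
  arguments -q x^2 and -q/x^2 up to the symmetries of base q^4, and G(x) = q x g(-q x^2; q^4) -
  (q/x^2) g(-q/x^2; q^4) satisfies G(qx) = -q x^3 G(x) - 1 + q x^2. So F + G has a homogeneous
  equation, and the product of the three theta functions supplies the inverse multiplier.

  Taking base q^2 and x = q turns the two extra arguments into -q^4 and -1 with base q^8. The mock
  terms are then already sorted by parity in q, and at every splitting only eta quotients in J_1
  have to be dissected.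

  Everything is an identity of convergent series at complex q: parts of a series are separated by
  evaluating at both square roots of q. The origin is treated apart, because g divides by x.\<close>

lemma qpoch_0 [simp]: "qpoch a q 0 = 1"
  by (simp add: qpoch_def)

lemma qpoch_Suc: "qpoch a q (Suc n) = qpoch a q n * (1 - a * q ^ n)"
  by (simp add: qpoch_def)

lemma qpoch_add: "qpoch a q (m + n) = qpoch a q m * qpoch (a * q ^ m) q n"
  by (induction n) (simp_all add: qpoch_Suc power_add mult_ac)

lemma qpoch_zero_left [simp]: "qpoch 0 q n = 1"
  by (simp add: qpoch_def)

lemma qpoch_inf_zero_left [simp]: "qpoch_inf 0 q = 1"
  by (simp add: qpoch_inf_def)

lemma summable_norm_geometric:
  fixes q :: complex
  assumes "norm q < 1"
  shows "summable (\<lambda>k. norm (a * q ^ k))"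
  using assms by (simp add: norm_mult norm_power summable_geometric summable_mult)

lemma convergent_qpoch_factors:
  fixes q :: complex
  assumes "norm q < 1"
  shows "convergent_prod (\<lambda>k. 1 - a * q ^ k)"
proof -
  have "abs_convergent_prod (\<lambda>k. 1 - a * q ^ k)"
    using summable_norm_geometric[OF assms, of a]
    by (simp add: abs_convergent_prod_conv_summable)
  then show ?thesis
    by (rule abs_convergent_prod_imp_convergent_prod)
qed

lemma qpoch_tendsto:
  assumes "norm q < 1"
  shows "(\<lambda>n. qpoch a q n) \<longlonglongrightarrow> qpoch_inf a q"
proof -
  have "(\<lambda>n. qpoch a q (Suc n)) \<longlonglongrightarrow> qpoch_inf a q"
    using convergent_prod_LIMSEQ[OF convergent_qpoch_factors[OF assms, of a]]
    by (simp add: qpoch_def qpoch_inf_def lessThan_Suc_atMost)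
  then show ?thesis
    by (simp add: filterlim_sequentially_Suc)
qed

lemma qpoch_inf_add:
  assumes "norm q < 1"
  shows "qpoch_inf a q = qpoch a q n * qpoch_inf (a * q ^ n) q"
proof (rule LIMSEQ_unique)
  show "(\<lambda>m. qpoch a q (n + m)) \<longlonglongrightarrow> qpoch_inf a q"
    using LIMSEQ_ignore_initial_segment[OF qpoch_tendsto[OF assms, of a], of n]
    by (simp add: add.commute)
  show "(\<lambda>m. qpoch a q (n + m)) \<longlonglongrightarrow> qpoch a q n * qpoch_inf (a * q ^ n) q"
    unfolding qpoch_add by (intro tendsto_intros qpoch_tendsto assms)
qed

lemma qpoch_inf_Suc:
  assumes "norm q < 1"
  shows "qpoch_inf a q = (1 - a) * qpoch_inf (a * q) q"
  using qpoch_inf_add[OF assms, of a 1] by (simp add: qpoch_Suc)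

text \<open>The bound does not depend on \<open>n\<close>, so it survives in the infinite product.
  There it serves twice: as a majorant for the series below and for continuity in \<open>q\<close>
  at the origin.\<close>

lemma norm_qpoch_minus_1_le:
  assumes "norm q < 1"
  shows "norm (qpoch a q n - 1) \<le> exp (norm a / (1 - norm q)) - 1"
proof -
  have "norm (qpoch a q n - 1) = norm ((\<Prod>k<n. 1 + (- (a * q ^ k))) - 1)"
    by (simp add: qpoch_def)
  also have "\<dots> \<le> (\<Prod>k<n. 1 + norm (- (a * q ^ k))) - 1"
    by (rule norm_prod_minus1_le_prod_minus1)
  also have "\<dots> \<le> exp (\<Sum>k<n. norm (- (a * q ^ k))) - 1"
    using prod_le_exp_sum[of "{..<n}" "\<lambda>k. norm (- (a * q ^ k))"] by simp
  also have "(\<Sum>k<n. norm (- (a * q ^ k))) \<le> (\<Sum>k. norm (a * q ^ k))"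
    using summable_norm_geometric[OF assms, of a]
    by (simp add: sum_le_suminf)
  also have "(\<Sum>k. norm (a * q ^ k)) = norm a / (1 - norm q)"
    using assms by (simp add: norm_mult norm_power suminf_mult summable_geometric suminf_geometric)
  finally show ?thesis by simp
qed

lemma norm_qpoch_inf_minus_1_le:
  assumes "norm q < 1"
  shows "norm (qpoch_inf a q - 1) \<le> exp (norm a / (1 - norm q)) - 1"
proof (rule tendsto_upperbound)
  show "(\<lambda>n. norm (qpoch a q n - 1)) \<longlonglongrightarrow> norm (qpoch_inf a q - 1)"
    by (intro tendsto_intros qpoch_tendsto assms)
qed (use norm_qpoch_minus_1_le[OF assms] in auto)

lemma norm_qpoch_inf_le:
  assumes "norm q < 1"
  shows "norm (qpoch_inf a q) \<le> exp (norm a / (1 - norm q))"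
  using norm_qpoch_inf_minus_1_le[OF assms, of a] norm_triangle_ineq2[of "qpoch_inf a q" 1] by simp

lemma qpoch_inf_nonzero:
  assumes "norm q < 1" "\<And>k. a * q ^ k \<noteq> 1"
  shows "qpoch_inf a q \<noteq> 0"
  unfolding qpoch_inf_def
  by (rule prodinf_nonzero[OF convergent_qpoch_factors[OF assms(1)]]) (use assms(2) in auto)

lemma qpoch_inf_nonzero':
  assumes "norm q < 1" "norm a < 1"
  shows "qpoch_inf a q \<noteq> 0"
proof (rule qpoch_inf_nonzero[OF assms(1)])
  fix k
  have "norm (a * q ^ k) \<le> norm a * 1"
    unfolding norm_mult norm_power
    by (intro mult_left_mono power_le_one) (use assms in auto)
  then show "a * q ^ k \<noteq> 1"
    using assms(2) by (metis mult.right_neutral norm_one not_le)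
qed

lemma qpoch_even_odd: "qpoch a q (2 * n) = qpoch a (q\<^sup>2) n * qpoch (a * q) (q\<^sup>2) n"
  by (induction n) (simp_all add: qpoch_Suc power_mult mult_ac flip: power_mult)

lemma qpoch_inf_even_odd:
  assumes "norm q < 1"
  shows "qpoch_inf a q = qpoch_inf a (q\<^sup>2) * qpoch_inf (a * q) (q\<^sup>2)"
proof (rule LIMSEQ_unique)
  have "norm (q\<^sup>2) < 1"
    using assms by (simp add: norm_power power_less_one_iff abs_square_less_1)
  then show "(\<lambda>n. qpoch a q (2 * n)) \<longlonglongrightarrow> qpoch_inf a (q\<^sup>2) * qpoch_inf (a * q) (q\<^sup>2)"
    unfolding qpoch_even_odd by (intro tendsto_intros qpoch_tendsto)
  show "(\<lambda>n. qpoch a q (2 * n)) \<longlonglongrightarrow> qpoch_inf a q"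
    using LIMSEQ_subseq_LIMSEQ[OF qpoch_tendsto[OF assms], of "\<lambda>n. 2 * n" a]
    by (simp add: o_def strict_mono_def)
qed

lemma qpoch_square: "qpoch (a\<^sup>2) (q\<^sup>2) n = qpoch a q n * qpoch (- a) q n"
  by (induction n) (simp_all add: qpoch_Suc algebra_simps power2_eq_square power_mult_distrib)

lemma qpoch_inf_square:
  assumes "norm q < 1"
  shows "qpoch_inf (a\<^sup>2) (q\<^sup>2) = qpoch_inf a q * qpoch_inf (- a) q"
proof (rule LIMSEQ_unique)
  have "norm (q\<^sup>2) < 1"
    using assms by (simp add: norm_power power_less_one_iff abs_square_less_1)
  then show "(\<lambda>n. qpoch (a\<^sup>2) (q\<^sup>2) n) \<longlonglongrightarrow> qpoch_inf (a\<^sup>2) (q\<^sup>2)"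
    by (rule qpoch_tendsto)
  show "(\<lambda>n. qpoch (a\<^sup>2) (q\<^sup>2) n) \<longlonglongrightarrow> qpoch_inf a q * qpoch_inf (- a) q"
    unfolding qpoch_square by (intro tendsto_intros qpoch_tendsto assms)
qed

lemma holomorphic_qpoch_inf: "norm q < 1 \<Longrightarrow> (\<lambda>a. qpoch_inf a q) holomorphic_on UNIV"
proof (rule holomorphic_uniform_sequence[where f = "\<lambda>n a. qpoch a q n"])
  assume q: "norm q < 1"
  show "(\<lambda>a. qpoch a q n) holomorphic_on UNIV" for n
    unfolding qpoch_def by (intro holomorphic_intros)
  show "\<exists>d>0. cball x d \<subseteq> UNIV \<and>
          uniform_limit (cball x d) (\<lambda>n a. qpoch a q n) (\<lambda>a. qpoch_inf a q) sequentially" for x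
  proof (intro exI[of _ 1] conjI)
    have "uniformly_convergent_on (cball x 1) (\<lambda>N a. \<Sum>n<N. norm (- (a * q ^ n)))"
    proof (rule Weierstrass_m_test')
      show "summable (\<lambda>n. norm (of_real (norm x + 1) * q ^ n))"
        by (rule summable_norm_geometric[OF q])
      fix n a
      assume "a \<in> cball x 1"
      then have "norm a \<le> norm x + 1"
        using norm_triangle_ineq2[of a x] by (simp add: dist_norm norm_minus_commute)
      then show "norm (norm (- (a * q ^ n))) \<le> norm (of_real (norm x + 1) * q ^ n)"
        by (simp only: norm_mult norm_minus_cancel norm_of_real real_norm_def abs_mult abs_norm_cancel)
           (intro mult_right_mono, auto)
    qed
    then have "uniformly_convergent_on (cball x 1) (\<lambda>N a. \<Prod>n<N. 1 + (- (a * q ^ n)))"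
      by (intro uniformly_convergent_on_prod) (auto intro!: continuous_intros)
    then have "uniformly_convergent_on (cball x 1) (\<lambda>N a. qpoch a q N)"
      by (simp add: qpoch_def)
    then have "uniform_limit (cball x 1) (\<lambda>N a. qpoch a q N) (\<lambda>a. lim (\<lambda>N. qpoch a q N)) sequentially"
      by (simp add: uniformly_convergent_uniform_limit_iff)
    then show "uniform_limit (cball x 1) (\<lambda>n a. qpoch a q n) (\<lambda>a. qpoch_inf a q) sequentially"
      using limI[OF qpoch_tendsto[OF q]] by simp
  qed auto
qed auto

lemma holomorphic_on_qpoch_inf [holomorphic_intros]:
  assumes "norm q < 1" "f holomorphic_on A"
  shows "(\<lambda>x. qpoch_inf (f x) q) holomorphic_on A"
  using holomorphic_on_compose_gen[OF assms(2) holomorphic_qpoch_inf[OF assms(1)]]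
  by (simp add: o_def)

section \<open>The theta function and the numerator of the universal mock theta function\<close>

definition jtheta :: "complex \<Rightarrow> complex \<Rightarrow> complex" where
  "jtheta x q = qpoch_inf x q * qpoch_inf (q / x) q"

text \<open>Multiplying \<open>mock_g x q\<close> by the theta function clears its poles; the result is holomorphic
  in \<open>x\<close> on the punctured plane.\<close>

definition mock_num_term :: "complex \<Rightarrow> complex \<Rightarrow> nat \<Rightarrow> complex" where
  "mock_num_term x q n =
     q ^ (n * (n + 1)) * qpoch_inf (x * q ^ (n + 1)) q * qpoch_inf (q ^ (n + 2) / x) q"

definition mock_num :: "complex \<Rightarrow> complex \<Rightarrow> complex" where
  "mock_num x q = (\<Sum>n. mock_num_term x q n)"

context
  fixes q :: complex
  assumes q: "norm q < 1" and q_nz: "q \<noteq> 0"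
begin

lemma norm_qpoch_inf_mult_power_le: "norm (qpoch_inf (a * q ^ n) q) \<le> exp (norm a / (1 - norm q))"
proof -
  have "norm (a * q ^ n) \<le> norm a * 1"
    unfolding norm_mult norm_power by (intro mult_left_mono power_le_one) (use q in auto)
  then have "norm (a * q ^ n) / (1 - norm q) \<le> norm a / (1 - norm q)"
    using q by (intro divide_right_mono) auto
  then show ?thesis
    using norm_qpoch_inf_le[OF q, of "a * q ^ n"] by (meson exp_le_cancel_iff order_trans)
qed

text \<open>A common majorant for the series and telescoping sequences below: the products are
  bounded uniformly in the shifts \<open>i\<close> and \<open>j\<close>, so an exponent of at least
  \<open>n\<close> already forces geometric decay.\<close>

lemma norm_power_mult_qpoch_inf_le:
  assumes "n \<le> m" "norm a \<le> R" "norm b \<le> R"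
  shows "norm (q ^ m * qpoch_inf (a * q ^ i) q * qpoch_inf (b * q ^ j) q)
           \<le> norm q ^ n * exp (R / (1 - norm q)) ^ 2"
proof -
  have *: "norm (qpoch_inf (c * q ^ l) q) \<le> exp (R / (1 - norm q))" if "norm c \<le> R" for c l
  proof -
    have "norm c / (1 - norm q) \<le> R / (1 - norm q)"
      using q that by (intro divide_right_mono) auto
    then show ?thesis
      using norm_qpoch_inf_mult_power_le[of c l] by (meson exp_le_cancel_iff order_trans)
  qed
  have "norm q ^ m \<le> norm q ^ n"
    using q assms(1) by (intro power_decreasing) auto
  then show ?thesis
    unfolding norm_mult norm_power power2_eq_square mult.assoc
    by (intro mult_mono *) (use assms in auto)
qed

lemma summable_power_norm_mult: "summable (\<lambda>n. norm q ^ n * C)"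
  using q by (intro summable_mult2 summable_geometric) auto

lemma power_mult_qpoch_inf_tendsto_0:
  assumes "\<And>n. n \<le> m n"
  shows "(\<lambda>n. q ^ m n * qpoch_inf (a * q ^ i n) q * qpoch_inf (b * q ^ j n) q) \<longlonglongrightarrow> 0"
proof (rule Lim_null_comparison)
  let ?C = "exp (max (norm a) (norm b) / (1 - norm q)) ^ 2"
  show "\<forall>\<^sub>F n in sequentially. norm (q ^ m n * qpoch_inf (a * q ^ i n) q * qpoch_inf (b * q ^ j n) q)
          \<le> norm q ^ n * ?C"
    by (intro always_eventually allI norm_power_mult_qpoch_inf_le assms) auto
  show "(\<lambda>n. norm q ^ n * ?C) \<longlonglongrightarrow> 0"
    by (rule summable_LIMSEQ_zero[OF summable_power_norm_mult])
qed

lemma mock_num_term_eq: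
  "mock_num_term x q n =
     q ^ (n * (n + 1)) * qpoch_inf (x * q ^ (n + 1)) q * qpoch_inf ((1 / x) * q ^ (n + 2)) q"
  by (simp add: mock_num_term_def)

lemma norm_mock_num_term_le:
  assumes "norm x \<le> R" "norm (1 / x) \<le> R"
  shows "norm (mock_num_term x q n) \<le> norm q ^ n * exp (R / (1 - norm q)) ^ 2"
  unfolding mock_num_term_eq using assms by (intro norm_power_mult_qpoch_inf_le) auto

lemma mock_num_sums: "mock_num_term x q sums mock_num x q"
proof -
  have "summable (mock_num_term x q)"
    by (rule summable_comparison_test'[OF summable_power_norm_mult])
       (rule norm_mock_num_term_le[where R = "max (norm x) (norm (1 / x))"], auto)
  then show ?thesis
    by (simp add: mock_num_def summable_sums)
qed

lemma holomorphic_mock_num: "(\<lambda>x. mock_num x q) holomorphic_on - {0}"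
proof (rule holomorphic_uniform_sequence[where f = "\<lambda>N x. \<Sum>n<N. mock_num_term x q n"])
  show "(\<lambda>x. \<Sum>n<N. mock_num_term x q n) holomorphic_on - {0}" for N
    unfolding mock_num_term_def by (intro holomorphic_intros q) auto
  fix x :: complex
  assume "x \<in> - {0}"
  then have x: "norm x > 0" by simp
  show "\<exists>d>0. cball x d \<subseteq> - {0} \<and>
          uniform_limit (cball x d) (\<lambda>N x. \<Sum>n<N. mock_num_term x q n) (\<lambda>x. mock_num x q) sequentially"
  proof (intro exI[of _ "norm x / 2"] conjI)
    show "cball x (norm x / 2) \<subseteq> - {0}"
      using x by (auto simp: dist_norm)
    show "uniform_limit (cball x (norm x / 2)) (\<lambda>N x. \<Sum>n<N. mock_num_term x q n)
            (\<lambda>x. mock_num x q) sequentially"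
      unfolding mock_num_def
    proof (rule Weierstrass_m_test)
      fix n y
      assume "y \<in> cball x (norm x / 2)"
      then have y: "norm (x - y) \<le> norm x / 2" by (simp add: dist_norm)
      have 1: "norm x / 2 \<le> norm y"
        using y norm_triangle_ineq2[of x y] by linarith
      have "norm y \<le> 2 * norm x"
        using y norm_triangle_ineq2[of y x] norm_minus_commute[of x y] norm_ge_zero[of x] by linarith
      moreover have "norm y > 0"
        using x 1 by linarith
      then have "norm (1 / y) \<le> 2 / norm x"
        using x 1 by (simp add: norm_divide field_simps)
      moreover have "2 * norm x \<le> 2 * norm x + 2 / norm x" "2 / norm x \<le> 2 * norm x + 2 / norm x"
        using x by auto
      ultimately show "norm (mock_num_term y q n)
          \<le> norm q ^ n * exp ((2 * norm x + 2 / norm x) / (1 - norm q)) ^ 2"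
        by (intro norm_mock_num_term_le) linarith+
    qed (rule summable_power_norm_mult)
  qed (use x in auto)
qed auto

lemma holomorphic_jtheta: "(\<lambda>x. jtheta x q) holomorphic_on - {0}"
  unfolding jtheta_def by (intro holomorphic_intros q) auto

lemma jtheta_reflect: "x \<noteq> 0 \<Longrightarrow> jtheta (q / x) q = jtheta x q"
  using q_nz by (simp add: jtheta_def)

lemma jtheta_shift:
  assumes "x \<noteq> 0"
  shows "jtheta (q * x) q = - jtheta x q / x"
proof -
  have "jtheta (q * x) q = qpoch_inf (q * x) q * ((1 - 1 / x) * qpoch_inf (q / x) q)"
    using q_nz qpoch_inf_Suc[OF q, of "1 / x"] by (simp add: jtheta_def)
  also have "\<dots> = - ((1 - x) * qpoch_inf (q * x) q * qpoch_inf (q / x) q) / x"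
    using assms by (simp add: field_simps)
  also have "\<dots> = - jtheta x q / x"
    using qpoch_inf_Suc[OF q, of x] by (simp add: jtheta_def mult.commute)
  finally show ?thesis .
qed

lemma jtheta_1 [simp]: "jtheta 1 q = 0"
  using qpoch_inf_Suc[OF q, of 1] by (simp add: jtheta_def)

lemma mock_num_reflect: "x \<noteq> 0 \<Longrightarrow> mock_num (q / x) q = mock_num x q"
  using q_nz unfolding mock_num_def mock_num_term_def
  by (simp add: mult_ac)

text \<open>The combination of the two series telescopes along the symmetric sequence
  \<open>h\<close>. The boundary value comes with the factor 1 - x^2, and
  \<open>(1 - x) * h 0\<close> is \<open>jtheta x q\<close>: this is the source of the inhomogeneous
  term.\<close>

lemma mock_num_shift:
  assumes x: "x \<noteq> 0"
  shows "mock_num (q * x) q = x\<^sup>2 * mock_num x q + (1 + x) * jtheta x q"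
proof -
  define h where
    "h = (\<lambda>n. q ^ (n * (n + 1)) * qpoch_inf (x * q ^ (n + 1)) q * qpoch_inf ((1 / x) * q ^ (n + 1)) q)"
  have step: "mock_num_term (q * x) q n - x\<^sup>2 * mock_num_term x q n = (1 - x\<^sup>2) * (h n - h (Suc n))" for n
  proof -
    define u v c where "u = qpoch_inf (x * q ^ (n + 2)) q" and "v = qpoch_inf ((1 / x) * q ^ (n + 2)) q"
      and "c = q ^ (n * (n + 1))"
    have u: "qpoch_inf (x * q ^ (n + 1)) q = (1 - x * q ^ (n + 1)) * u"
      using qpoch_inf_Suc[OF q, of "x * q ^ (n + 1)"] by (simp add: u_def mult_ac)
    have v: "qpoch_inf ((1 / x) * q ^ (n + 1)) q = (1 - (1 / x) * q ^ (n + 1)) * v"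
      using qpoch_inf_Suc[OF q, of "(1 / x) * q ^ (n + 1)"] by (simp add: v_def mult_ac)
    have 1: "mock_num_term (q * x) q n = c * u * ((1 - (1 / x) * q ^ (n + 1)) * v)"
      unfolding mock_num_term_eq v[symmetric] using q_nz by (simp add: c_def u_def mult_ac)
    have 2: "mock_num_term x q n = c * ((1 - x * q ^ (n + 1)) * u) * v"
      unfolding mock_num_term_eq u[symmetric] by (simp add: c_def v_def)
    have 3: "h n = c * ((1 - x * q ^ (n + 1)) * u) * ((1 - (1 / x) * q ^ (n + 1)) * v)"
      unfolding h_def u v by (simp add: c_def)
    have 4: "h (Suc n) = c * (q ^ (n + 1))\<^sup>2 * u * v"
      by (simp add: h_def c_def u_def v_def power2_eq_square algebra_simps power_add)
    define p where "p = q ^ (n + 1)"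
    show ?thesis
      unfolding 1 2 3 4 p_def[symmetric] using x by (simp add: field_simps power2_eq_square)
  qed
  have "h \<longlonglongrightarrow> 0"
    unfolding h_def by (rule power_mult_qpoch_inf_tendsto_0) simp
  then have "(\<lambda>n. (1 - x\<^sup>2) * (h n - h (Suc n))) sums ((1 - x\<^sup>2) * (h 0 - 0))"
    by (intro sums_mult telescope_sums')
  moreover have "(\<lambda>n. mock_num_term (q * x) q n - x\<^sup>2 * mock_num_term x q n) sums
      (mock_num (q * x) q - x\<^sup>2 * mock_num x q)"
    by (intro sums_diff sums_mult mock_num_sums)
  ultimately have "mock_num (q * x) q - x\<^sup>2 * mock_num x q = (1 - x\<^sup>2) * h 0"
    by (simp add: step sums_iff)
  also have "\<dots> = (1 + x) * jtheta x q"
    unfolding jtheta_def qpoch_inf_Suc[OF q, of x]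
    by (simp add: h_def algebra_simps power2_eq_square)
  finally show ?thesis by (simp add: algebra_simps)
qed

text \<open>After division by (q;q)_inf^2 this is the Durfee rectangle identity, the sum of
  q^(n(n+k)) / ((q;q)_n (q;q)_(n+k)) being 1 / (q;q)_inf, for k = 1. \<open>M k\<close> is the sum
  for general k. It does not depend on k, and as k tends to infinity only the term n = 0
  survives.\<close>

lemma mock_num_1: "mock_num 1 q = qpoch_inf q q"
proof -
  define t where
    "t = (\<lambda>k n. q ^ (n * n + n * k) * qpoch_inf (q * q ^ n) q * qpoch_inf (q * q ^ (n + k)) q)"
  define M where "M = (\<lambda>k. suminf (t k))"
  have nt: "norm (t k n) \<le> norm q ^ n * exp (norm q / (1 - norm q)) ^ 2" for k n
    unfolding t_def by (rule norm_power_mult_qpoch_inf_le) (simp_all add: trans_le_add1)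
  have sums: "t k sums M k" for k
    unfolding M_def
    by (intro summable_sums summable_comparison_test'[OF summable_power_norm_mult nt])
  have "M (Suc k) = M k" for k
  proof -
    define u where
      "u = (\<lambda>n. q ^ (n * n + n * k) * qpoch_inf (1 * q ^ n) q * qpoch_inf (q * q ^ (n + k)) q)"
    have "t k n - t (Suc k) n = u n - u (Suc n)" for n
    proof -
      have a: "qpoch_inf (1 * q ^ n) q = (1 - q ^ n) * qpoch_inf (q * q ^ n) q"
        using qpoch_inf_Suc[OF q, of "q ^ n"] by (simp add: mult_ac)
      have b: "qpoch_inf (q * q ^ (n + k)) q = (1 - q * q ^ (n + k)) * qpoch_inf (q * q ^ (n + Suc k)) q"
        using qpoch_inf_Suc[OF q, of "q * q ^ (n + k)"] by (simp add: mult_ac)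
      show ?thesis
        unfolding u_def t_def a b
        by (simp add: algebra_simps power_add)
    qed
    moreover have "u \<longlonglongrightarrow> 0"
      unfolding u_def by (rule power_mult_qpoch_inf_tendsto_0) (simp add: trans_le_add1)
    then have "(\<lambda>n. u n - u (Suc n)) sums (u 0 - 0)"
      by (rule telescope_sums')
    \<comment> \<open>The product in \<open>u 0\<close> starts with the factor 1 - q^0, so the
      telescoping sum has no boundary term.\<close>
    moreover have "u 0 = 0"
      using qpoch_inf_Suc[OF q, of 1] by (simp add: u_def)
    moreover have "(\<lambda>n. t k n - t (Suc k) n) sums (M k - M (Suc k))"
      by (intro sums_diff sums)
    ultimately show ?thesis by (simp add: sums_iff)
  qed
  then have const: "M k = M 0" for k by (induction k) auto
  have "M \<longlonglongrightarrow> qpoch_inf q q"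
  proof -
    define C where "C = exp (norm q / (1 - norm q)) ^ 2"
    have "(\<lambda>k. M k - t k 0) \<longlonglongrightarrow> 0"
    proof (rule Lim_null_comparison)
      show "(\<lambda>k. norm q ^ k * (\<Sum>n. norm q ^ n * C)) \<longlonglongrightarrow> 0"
        by (rule summable_LIMSEQ_zero[OF summable_power_norm_mult])
      have "norm (M k - t k 0) \<le> norm q ^ k * (\<Sum>n. norm q ^ n * C)" for k
      proof -
        have le: "norm (t k (Suc n)) \<le> norm q ^ k * (norm q ^ n * C)" for n
        proof -
          have "norm (t k (Suc n)) \<le> norm q ^ (k + n) * C"
            unfolding t_def C_def by (rule norm_power_mult_qpoch_inf_le) auto
          then show ?thesis by (simp add: power_add mult_ac)
        qed
        have "(\<lambda>n. t k (Suc n)) sums (M k - t k 0)"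
          using sums[of k] by (simp add: sums_Suc_iff)
        moreover have "summable (\<lambda>n. norm q ^ k * (norm q ^ n * C))"
          by (intro summable_mult summable_power_norm_mult)
        ultimately have "norm (M k - t k 0) \<le> (\<Sum>n. norm q ^ k * (norm q ^ n * C))"
          using norm_suminf_le[of "\<lambda>n. t k (Suc n)", OF le] by (simp add: sums_iff)
        then show ?thesis
          by (simp add: suminf_mult summable_power_norm_mult)
      qed
      then show "\<forall>\<^sub>F k in sequentially. norm (M k - t k 0) \<le> norm q ^ k * (\<Sum>n. norm q ^ n * C)"
        by simp
    qed
    moreover have "(\<lambda>k. t k 0) \<longlonglongrightarrow> qpoch_inf q q"
    proof -
      have "isCont (\<lambda>a. qpoch_inf a q) 0"
        using holomorphic_on_imp_continuous_on[OF holomorphic_qpoch_inf[OF q]]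
        by (simp add: continuous_on_eq_continuous_at)
      moreover have "(\<lambda>k. q * q ^ k) \<longlonglongrightarrow> 0"
        using q by (intro tendsto_mult_right_zero LIMSEQ_power_zero)
      ultimately have "(\<lambda>k. qpoch_inf (q * q ^ k) q) \<longlonglongrightarrow> 1"
        using isCont_tendsto_compose[of 0 "\<lambda>a. qpoch_inf a q" "\<lambda>k. q * q ^ k" sequentially] by simp
      then have "(\<lambda>k. qpoch_inf q q * qpoch_inf (q * q ^ k) q) \<longlonglongrightarrow> qpoch_inf q q * 1"
        by (intro tendsto_mult tendsto_const)
      then show ?thesis by (simp add: t_def)
    qed
    ultimately have "(\<lambda>k. (M k - t k 0) + t k 0) \<longlonglongrightarrow> 0 + qpoch_inf q q"
      by (rule tendsto_add)
    then show ?thesis by simp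
  qed
  moreover have "M = (\<lambda>_. M 1)"
    using const[of 1] const by (intro ext) metis
  ultimately have "M 1 = qpoch_inf q q"
    by (metis LIMSEQ_const_iff)
  moreover have "t 1 = mock_num_term 1 q"
    by (rule ext) (simp add: t_def mock_num_term_def algebra_simps)
  ultimately show ?thesis
    by (simp add: M_def mock_num_def)
qed

text \<open>The series in \<open>mock_g\<close> is lopsided, with n + 1 factors against n, while
  \<open>mock_num\<close> is symmetric. Passing from one to the other telescopes along
  \<open>T\<close>, and the boundary value \<open>T 0 = jtheta x q\<close> is absorbed by the
  \<open>- 1\<close> in \<open>mock_g\<close>.\<close>

lemma jtheta_mult_mock_g:
  assumes x: "x \<noteq> 0" and nz: "jtheta x q \<noteq> 0"
  shows "jtheta x q * mock_g x q = mock_num x q"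
proof -
  define T where
    "T = (\<lambda>n. q ^ (n * n) * qpoch_inf (x * q ^ n) q * qpoch_inf ((q / x) * q ^ n) q)"
  define a where "a = (\<lambda>n. q ^ (n\<^sup>2) / (qpoch x q (n + 1) * qpoch (q / x) q n))"
  have step: "jtheta x q * a n = x * mock_num_term x q n + (T n - T (Suc n))" for n
  proof -
    define u v c p where "u = qpoch_inf (x * q ^ Suc n) q" and "v = qpoch_inf ((q / x) * q ^ Suc n) q"
      and "c = q ^ (n * n)" and "p = q ^ n"
    have u: "qpoch_inf (x * q ^ n) q = (1 - x * p) * u"
      using qpoch_inf_Suc[OF q, of "x * q ^ n"] by (simp add: u_def p_def mult_ac)
    have v: "qpoch_inf ((q / x) * q ^ n) q = (1 - (q / x) * p) * v"
      using qpoch_inf_Suc[OF q, of "(q / x) * q ^ n"] by (simp add: v_def p_def mult_ac)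
    have "jtheta x q = qpoch x q (n + 1) * qpoch (q / x) q n * u * qpoch_inf ((q / x) * q ^ n) q"
      unfolding jtheta_def qpoch_inf_add[OF q, of x "n + 1"] qpoch_inf_add[OF q, of "q / x" n]
      by (simp add: u_def)
    then have 1: "jtheta x q * a n = c * u * ((1 - (q / x) * p) * v)"
      unfolding v a_def c_def using nz by (simp add: power2_eq_square)
    have 2: "mock_num_term x q n = c * p * u * v"
      by (simp add: mock_num_term_def c_def p_def u_def v_def algebra_simps power_add)
    have 3: "T n = c * ((1 - x * p) * u) * ((1 - (q / x) * p) * v)"
      unfolding T_def u v by (simp add: c_def)
    have 4: "T (Suc n) = c * q * p\<^sup>2 * u * v"
      by (simp add: T_def c_def p_def u_def v_def power2_eq_square algebra_simps power_add)
    show ?thesis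
      unfolding 1 2 3 4 using x by (simp add: algebra_simps power2_eq_square)
  qed
  have "T \<longlonglongrightarrow> 0"
    unfolding T_def by (rule power_mult_qpoch_inf_tendsto_0) simp
  then have "(\<lambda>n. x * mock_num_term x q n + (T n - T (Suc n))) sums (x * mock_num x q + (T 0 - 0))"
    by (intro sums_add sums_mult mock_num_sums telescope_sums')
  then have "(\<lambda>n. jtheta x q * a n) sums (x * mock_num x q + jtheta x q)"
    unfolding step by (simp add: T_def jtheta_def)
  then have "(\<lambda>n. inverse (jtheta x q) * (jtheta x q * a n)) sums
      (inverse (jtheta x q) * (x * mock_num x q + jtheta x q))"
    by (rule sums_mult)
  then have "a sums (x * mock_num x q / jtheta x q + 1)"
    using nz by (simp add: field_simps)
  then have "mock_g x q = mock_num x q / jtheta x q"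
    using x by (simp add: mock_g_def a_def sums_iff)
  then show ?thesis using nz by simp
qed

end

section \<open>Identities on the fundamental annulus\<close>

text \<open>A holomorphic function on the torus of the punctured plane modulo x -> qx is constant.
  The open annulus is wider than a fundamental domain, and periodicity is required only where both x
  and qx lie in it.\<close>

lemma q_periodic_holomorphic_constant:
  fixes q :: complex
  defines "S \<equiv> {x. norm q < norm x \<and> norm x < 1 / norm q}"
  assumes q: "norm q < 1" and q_nz: "q \<noteq> 0"
    and hol: "R holomorphic_on S"
    and per: "\<And>x. 1 < norm x \<Longrightarrow> norm x < 1 / norm q \<Longrightarrow> R (q * x) = R x"
    and x: "x \<in> S" and y: "y \<in> S"
  shows "R x = R y"
proof -
  define r where "r = norm q"
  \<comment> \<open>Any radius strictly between r and 1 would do: the compact annulus s <= |z| <=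
    s/r lies inside \<open>S\<close>, and each point of \<open>S\<close> reaches it by at most one
    multiplication or division by q.\<close>
  define s where "s = (1 + r) / 2"
  have r: "0 < r" "r < 1" using q q_nz by (auto simp: r_def)
  then have s: "r < s" "s < 1" "1 < s / r" "s / r < 1 / r"
    by (auto simp: s_def field_simps)
  have S_eq: "S = ball 0 (1 / r) - cball 0 r"
    by (auto simp: S_def r_def)
  define C :: "complex set" where "C = cball 0 (s / r) - ball 0 s"
  have C_iff: "z \<in> C \<longleftrightarrow> s \<le> norm z \<and> norm z \<le> s / r" for z
    by (auto simp: C_def)
  have "C \<subseteq> S" using s by (auto simp: C_iff S_def r_def)
  have "continuous_on S R" using hol by (rule holomorphic_on_imp_continuous_on)
  then have "continuous_on C (\<lambda>z. norm (R z))"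
    using \<open>C \<subseteq> S\<close> by (intro continuous_on_norm) (rule continuous_on_subset)
  moreover have "compact C" unfolding C_def by (intro compact_diff) auto
  moreover have "1 \<in> C" using s by (simp add: C_iff)
  ultimately obtain \<xi> where \<xi>: "\<xi> \<in> C" "\<And>z. z \<in> C \<Longrightarrow> norm (R z) \<le> norm (R \<xi>)"
    using continuous_attains_sup[of C "\<lambda>z. norm (R z)"] by blast
  have max: "norm (R z) \<le> norm (R \<xi>)" if "z \<in> S" for z
  proof -
    have z: "r < norm z" "norm z < 1 / r" using that by (auto simp: S_def r_def)
    consider "z \<in> C" | "norm z < s" | "s / r < norm z" by (metis C_iff not_le)
    then show ?thesis
    proof cases
      case 2
      have n: "norm (z / q) = norm z / r" by (simp add: norm_divide r_def)
      have n1: "1 < norm (z / q)" "norm (z / q) < s / r"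
        using z r 2 by (simp_all add: n field_simps)
      then have "R z = R (z / q)"
        using per[of "z / q"] s q_nz by (simp add: r_def)
      moreover have "z / q \<in> C" using n1 s by (auto simp: C_iff)
      ultimately show ?thesis using \<xi>(2) by simp
    next
      case 3
      have n: "norm (q * z) = r * norm z" by (simp add: norm_mult r_def)
      have "s < norm (q * z)" "norm (q * z) < 1"
        using z r 3 by (simp_all add: n field_simps)
      then have "q * z \<in> C" using s by (auto simp: C_iff)
      moreover have "R (q * z) = R z" using per[of z] z s 3 by (auto simp: r_def)
      ultimately show ?thesis using \<xi>(2) by metis
    qed (use \<xi>(2) in auto)
  qed
  have "open S" unfolding S_eq by (intro open_Diff) auto
  moreover have "connected S"
    using connected_annulus(1)[of r "0::complex" "1 / r"] by (simp add: S_def r_def)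
  ultimately have "R constant_on S"
    using maximum_modulus_principle[OF hol, of S \<xi>] \<xi>(1) \<open>C \<subseteq> S\<close> max by blast
  then show ?thesis using x y by (auto simp: constant_on_def)
qed

lemma holomorphic_on_jtheta [holomorphic_intros]:
  assumes "norm q < 1" "q \<noteq> 0" "f holomorphic_on A" "\<And>x. x \<in> A \<Longrightarrow> f x \<noteq> 0"
  shows "(\<lambda>x. jtheta (f x) q) holomorphic_on A"
proof -
  have "f ` A \<subseteq> - {0}" using assms(4) by auto
  then show ?thesis
    using holomorphic_on_compose_gen[OF assms(3) holomorphic_jtheta[OF assms(1,2)]]
    by (simp add: o_def)
qed

lemma holomorphic_on_mock_num [holomorphic_intros]:
  assumes "norm q < 1" "q \<noteq> 0" "f holomorphic_on A" "\<And>x. x \<in> A \<Longrightarrow> f x \<noteq> 0"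
  shows "(\<lambda>x. mock_num (f x) q) holomorphic_on A"
proof -
  have "f ` A \<subseteq> - {0}" using assms(4) by auto
  then show ?thesis
    using holomorphic_on_compose_gen[OF assms(3) holomorphic_mock_num[OF assms(1,2)]]
    by (simp add: o_def)
qed

lemma norm_power_less_1: "norm (q :: complex) < 1 \<Longrightarrow> n > 0 \<Longrightarrow> norm (q ^ n) < 1"
  by (simp add: norm_power power_less_one_iff)

context
  fixes q :: complex
  assumes q: "norm q < 1" and q_nz: "q \<noteq> 0"
begin

lemma q4: "norm (q ^ 4) < 1" "q ^ 4 \<noteq> 0"
  using q q_nz by (auto intro: norm_power_less_1)

text \<open>The shift sends -q x^2 to -q^3 x^2, which is the reflection of -q/x^2 under y -> q^4/y.
  It sends -q/x^2 to -1/(q x^2), and one further factor q^4 gives the reflection of -q x^2. Hence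
  the two functions are exchanged, the second at the price of one functional equation.\<close>

lemma jtheta_quartic_shift:
  assumes x: "x \<noteq> 0"
  shows "jtheta (- q * (q * x)\<^sup>2) (q ^ 4) = jtheta (- q / x\<^sup>2) (q ^ 4)"
    and "jtheta (- q / (q * x)\<^sup>2) (q ^ 4) = jtheta (- q * x\<^sup>2) (q ^ 4) / (q * x\<^sup>2)"
proof -
  show "jtheta (- q * (q * x)\<^sup>2) (q ^ 4) = jtheta (- q / x\<^sup>2) (q ^ 4)"
    using jtheta_reflect[OF q4, of "- q / x\<^sup>2"] x q_nz
    by (simp add: field_simps power2_eq_square power4_eq_xxxx)
  have "q ^ 4 * (- q / (q * x)\<^sup>2) = q ^ 4 / (- q * x\<^sup>2)"
    using x q_nz by (simp add: field_simps power2_eq_square power4_eq_xxxx)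
  then have "jtheta (- q * x\<^sup>2) (q ^ 4) = - jtheta (- q / (q * x)\<^sup>2) (q ^ 4) / (- q / (q * x)\<^sup>2)"
    using jtheta_shift[OF q4, of "- q / (q * x)\<^sup>2"] jtheta_reflect[OF q4, of "- q * x\<^sup>2"] x q_nz
    by simp
  also have "\<dots> = q * x\<^sup>2 * jtheta (- q / (q * x)\<^sup>2) (q ^ 4)"
    using x q_nz by (simp add: field_simps power2_eq_square)
  finally show "jtheta (- q / (q * x)\<^sup>2) (q ^ 4) = jtheta (- q * x\<^sup>2) (q ^ 4) / (q * x\<^sup>2)"
    using x q_nz by (simp add: field_simps)
qed

lemma mock_num_quartic_shift:
  assumes x: "x \<noteq> 0"
  shows "mock_num (- q * (q * x)\<^sup>2) (q ^ 4) = mock_num (- q / x\<^sup>2) (q ^ 4)"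
    and "mock_num (- q / (q * x)\<^sup>2) (q ^ 4) =
           q\<^sup>2 * x ^ 4 * mock_num (- q * x\<^sup>2) (q ^ 4) - (q * x\<^sup>2 - 1) * jtheta (- q * x\<^sup>2) (q ^ 4)"
proof -
  show "mock_num (- q * (q * x)\<^sup>2) (q ^ 4) = mock_num (- q / x\<^sup>2) (q ^ 4)"
    using mock_num_reflect[OF q4, of "- q / x\<^sup>2"] x q_nz
    by (simp add: field_simps power2_eq_square power4_eq_xxxx)
  define y where "y = - q / (q * x)\<^sup>2"
  have y: "y \<noteq> 0" and y_eq: "y = - 1 / (q * x\<^sup>2)"
    using x q_nz by (auto simp: y_def field_simps power2_eq_square)
  have "q ^ 4 * y = q ^ 4 / (- q * x\<^sup>2)"
    using x q_nz by (simp add: y_def field_simps power2_eq_square power4_eq_xxxx)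
  then have K: "mock_num (- q * x\<^sup>2) (q ^ 4) = y\<^sup>2 * mock_num y (q ^ 4) + (1 + y) * jtheta y (q ^ 4)"
    using mock_num_shift[OF q4 y] mock_num_reflect[OF q4, of "- q * x\<^sup>2"] x q_nz by simp
  have j: "jtheta y (q ^ 4) = - y * jtheta (- q * x\<^sup>2) (q ^ 4)"
    using jtheta_quartic_shift(2)[OF x] unfolding y_def[symmetric] by (simp add: y_eq)
  have e: "q\<^sup>2 * x ^ 4 * mock_num (- q * x\<^sup>2) (q ^ 4) =
      (q\<^sup>2 * x ^ 4 * y\<^sup>2) * mock_num y (q ^ 4) - (q\<^sup>2 * x ^ 4 * y * (1 + y)) * jtheta (- q * x\<^sup>2) (q ^ 4)"
    unfolding K j by (simp add: algebra_simps)
  have c: "q\<^sup>2 * x ^ 4 * y\<^sup>2 = 1" "q\<^sup>2 * x ^ 4 * y * (1 + y) = 1 - q * x\<^sup>2"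
    using x q_nz by (simp_all add: y_eq field_simps power2_eq_square power4_eq_xxxx)
  show "mock_num (- q / (q * x)\<^sup>2) (q ^ 4) =
      q\<^sup>2 * x ^ 4 * mock_num (- q * x\<^sup>2) (q ^ 4) - (q * x\<^sup>2 - 1) * jtheta (- q * x\<^sup>2) (q ^ 4)"
    unfolding y_def[symmetric] e c by (simp add: algebra_simps)
qed

text \<open>The left-hand side is holomorphic on the punctured plane and invariant under \<open>x \<mapsto> q * x\<close>:
  the theta terms in the functional equations of the three mock numerators cancel. Hence it is
  constant, and at \<open>x = 1\<close> only one term survives.\<close>

lemma mock_num_theta_identity:
  assumes x: "norm q < norm x" "norm x < 1 / norm q"
  shows "jtheta (- q * x\<^sup>2) (q ^ 4) * jtheta (- q / x\<^sup>2) (q ^ 4) * (x * mock_num x q + jtheta x q)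
           - q / x\<^sup>2 * jtheta x q * jtheta (- q * x\<^sup>2) (q ^ 4) * mock_num (- q / x\<^sup>2) (q ^ 4)
           + q * x * jtheta x q * jtheta (- q / x\<^sup>2) (q ^ 4) * mock_num (- q * x\<^sup>2) (q ^ 4)
         = qpoch_inf q q * (jtheta (- q) (q ^ 4))\<^sup>2"
    (is "?W x = _")
proof -
  have "?W x = ?W 1"
  proof (rule q_periodic_holomorphic_constant[OF q q_nz, where R = ?W])
    show "?W holomorphic_on {x. norm q < norm x \<and> norm x < 1 / norm q}"
      by (intro holomorphic_intros q q_nz q4) (use q_nz in auto)
    show "(1 :: complex) \<in> {x. norm q < norm x \<and> norm x < 1 / norm q}"
      using q q_nz by simp
    fix x :: complex
    assume "1 < norm x"
    then have x: "x \<noteq> 0" by auto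
    have aux: "(B::complex) * (A / (q * x\<^sup>2)) * ((q * x) * (x\<^sup>2 * K + (1 + x) * j) + (- j / x))
           - q / (q * x)\<^sup>2 * (- j / x) * B * (q\<^sup>2 * x ^ 4 * KA - (q * x\<^sup>2 - 1) * A)
           + q * (q * x) * (- j / x) * (A / (q * x\<^sup>2)) * KB
         = A * B * (x * K + j) - q / x\<^sup>2 * j * A * KB + q * x * j * B * KA" for A B K j KA KB
      using x q_nz by (simp add: divide_simps) (simp add: algebra_simps power2_eq_square power4_eq_xxxx)
    show "?W (q * x) = ?W x"
      unfolding jtheta_quartic_shift[OF x] mock_num_quartic_shift[OF x]
        jtheta_shift[OF q q_nz x] mock_num_shift[OF q q_nz x]
      by (rule aux)
  qed (use x in auto)
  also have "\<dots> = qpoch_inf q q * (jtheta (- q) (q ^ 4))\<^sup>2"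
    by (simp add: q q_nz mock_num_1 power2_eq_square)
  finally show ?thesis .
qed

lemma jtheta_neg_1: "jtheta (- 1) q = 2 * (qpoch_inf (- q) q)\<^sup>2"
  using qpoch_inf_Suc[OF q, of "- 1"] by (simp add: jtheta_def power2_eq_square)

lemma jtheta_neg_quartic: "jtheta (- q) (q ^ 4) = qpoch_inf (- q) (q\<^sup>2)"
proof -
  have "q ^ 4 / (- q) = - q * q\<^sup>2"
    using q_nz by (simp add: field_simps power2_eq_square power4_eq_xxxx)
  then show ?thesis
    using qpoch_inf_even_odd[OF norm_power_less_1[OF q, of 2], of "- q"]
    by (simp add: jtheta_def)
qed

text \<open>The even and the odd part of the theta function. Both sides obey the same functional
  equation under \<open>x \<mapsto> q * x\<close> and vanish at \<open>x = 1\<close>, the only zero of \<open>jtheta x q\<close> in the annulus,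
  so their quotient is constant; it is evaluated at \<open>x = -1\<close>.\<close>

lemma jtheta_dissection:
  assumes x: "norm q < norm x" "norm x < 1 / norm q"
  shows "(jtheta (- q * x\<^sup>2) (q ^ 4) - x * jtheta (- q / x\<^sup>2) (q ^ 4)) * (qpoch_inf (- q) q)\<^sup>2
         = qpoch_inf (- q) (q\<^sup>2) * jtheta x q"
proof -
  let ?S = "{x :: complex. norm q < norm x \<and> norm x < 1 / norm q}"
  define f where "f = (\<lambda>x. jtheta (- q * x\<^sup>2) (q ^ 4) - x * jtheta (- q / x\<^sup>2) (q ^ 4))"
  define h where "h = (\<lambda>x. qpoch_inf (q * x) q * qpoch_inf (q / x) q)"
  have jt: "jtheta x q = (1 - x) * h x" for x
    using qpoch_inf_Suc[OF q, of x] by (simp add: jtheta_def h_def mult_ac)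
  have h_nz: "h x \<noteq> 0" if "x \<in> ?S" for x
  proof -
    have "norm q < norm x" using that by simp
    then have "norm x > 0" using norm_ge_zero[of q] by linarith
    then have "norm (q * x) < 1" "norm (q / x) < 1"
      using that q_nz by (simp_all add: norm_mult norm_divide field_simps)
    then show ?thesis unfolding h_def using q by (simp add: qpoch_inf_nonzero')
  qed
  have f1: "f 1 = 0" by (simp add: f_def)
  \<comment> \<open>Dividing \<open>f\<close> by the theta function directly would leave a removable
    singularity at 1. Passing to \<open>F\<close> and \<open>h\<close> splits the factor belonging
    to that zero off both functions.\<close>
  define F where "F = (\<lambda>z. if z = 1 then deriv f 1 else (f z - f 1) / (z - 1))"
  have "f holomorphic_on ?S"
    unfolding f_def by (intro holomorphic_intros q4) (use q_nz in auto)
  moreover have "open ?S"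
    by (intro open_Collect_conj open_Collect_less continuous_intros)
  ultimately have "F holomorphic_on ?S"
    unfolding F_def by (rule pole_lemma_open)
  moreover have "h holomorphic_on ?S"
    unfolding h_def by (intro holomorphic_intros q) auto
  ultimately have hol: "(\<lambda>x. F x / h x) holomorphic_on ?S"
    using h_nz by (intro holomorphic_intros) auto
  have F: "F x / h x = - f x / jtheta x q" if "x \<noteq> 1" for x
    using that by (simp add: F_def f1 jt divide_simps) (simp add: algebra_simps)
  have per: "F (q * x) / h (q * x) = F x / h x" if "1 < norm x" "norm x < 1 / norm q" for x
  proof -
    have x: "x \<noteq> 0" "x \<noteq> 1" using that by auto
    have "norm (q * x) < 1" using that q_nz by (simp add: norm_mult field_simps)
    then have "q * x \<noteq> 1" by auto
    have "f (q * x) = - f x / x"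
      unfolding f_def jtheta_quartic_shift[OF x(1)]
      using x q_nz by (simp add: field_simps power2_eq_square)
    then show ?thesis
      using x by (simp add: F[OF \<open>x \<noteq> 1\<close>] F[OF \<open>q * x \<noteq> 1\<close>] jtheta_shift[OF q q_nz])
  qed
  have one: "- 1 \<in> ?S" using q q_nz by simp
  have x_in: "x \<in> ?S" using x by simp
  have "f x * jtheta (- 1) q = f (- 1) * jtheta x q"
  proof (cases "x = 1")
    case False
    have "F x / h x = F (- 1) / h (- 1)"
      by (rule q_periodic_holomorphic_constant[OF q q_nz hol per x_in one])
    then have "f x / jtheta x q = f (- 1) / jtheta (- 1) q"
      using False by (simp add: F)
    moreover have "jtheta x q \<noteq> 0" "jtheta (- 1) q \<noteq> 0"
      using False h_nz[OF x_in] h_nz[OF one] by (simp_all add: jt)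
    ultimately show ?thesis by (simp add: field_simps)
  qed (simp add: f1 q q_nz)
  moreover have "f (- 1) = 2 * qpoch_inf (- q) (q\<^sup>2)"
    by (simp add: f_def jtheta_neg_quartic)
  ultimately have "2 * (f x * (qpoch_inf (- q) q)\<^sup>2) = 2 * (qpoch_inf (- q) (q\<^sup>2) * jtheta x q)"
    by (simp add: jtheta_neg_1 mult_ac)
  then show ?thesis
    by (simp add: f_def)
qed

end

section \<open>Eta quotients and their 2-dissections\<close>

lemma qpoch_inf_power_eq_J: "qpoch_inf (q ^ m) (q ^ m) = J q m"
  by (simp add: J_def)

lemma J_power: "J (q ^ k) m = J q (k * m)"
  by (simp add: J_def power_mult)

lemma J_zero_left [simp]: "m > 0 \<Longrightarrow> J 0 m = 1"
  by (simp add: J_def power_0_left)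

lemma J_nonzero:
  assumes "norm q < 1" "m > 0"
  shows "J q m \<noteq> 0"
  unfolding J_def using norm_power_less_1[OF assms] by (intro qpoch_inf_nonzero')

lemma J_uminus_even: "even m \<Longrightarrow> J (- q) m = J q m"
  by (simp add: J_def)

lemma norm_square_annulus:
  fixes q :: complex
  assumes q: "norm q < 1" and q_nz: "q \<noteq> 0"
  shows "norm (q\<^sup>2) < 1" "q\<^sup>2 \<noteq> 0" "norm (q\<^sup>2) < norm q" "norm q < 1 / norm (q\<^sup>2)"
proof -
  show "norm (q\<^sup>2) < 1" using q by (simp add: norm_power_less_1)
  show "norm (q\<^sup>2) < norm q"
    using q_nz q by (simp add: norm_mult power2_eq_square)
  have "norm q * norm (q\<^sup>2) < 1"
    using norm_power_less_1[OF q, of 3] by (simp add: norm_mult power3_eq_cube power2_eq_square)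
  then show "norm q < 1 / norm (q\<^sup>2)" using q_nz by (simp add: field_simps)
qed (use q_nz in auto)

context
  fixes q :: complex
  assumes q: "norm q < 1"
begin

lemma qpoch_inf_neg_power_same: "m > 0 \<Longrightarrow> qpoch_inf (- (q ^ m)) (q ^ m) = J q (2 * m) / J q m"
  using qpoch_inf_square[OF norm_power_less_1[OF q], of m "q ^ m"] J_nonzero[OF q, of m]
  by (simp add: J_def field_simps flip: power_mult)

lemma qpoch_inf_power_double:
  assumes "m > 0"
  shows "qpoch_inf (q ^ m) (q ^ (2 * m)) = J q m / J q (2 * m)"
proof -
  have "(q ^ m)\<^sup>2 = q ^ (2 * m)" "q ^ m * q ^ m = q ^ (2 * m)"
    by (simp_all add: mult_2 power_add power2_eq_square)
  then show ?thesis
    using qpoch_inf_even_odd[OF norm_power_less_1[OF q assms], of "q ^ m"] J_nonzero[OF q, of "2 * m"] assms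
    by (simp add: qpoch_inf_power_eq_J field_simps)
qed

lemma qpoch_inf_neg_power_double:
  assumes m: "m > 0"
  shows "qpoch_inf (- (q ^ m)) (q ^ (2 * m)) = (J q (2 * m))\<^sup>2 / (J q m * J q (4 * m))"
proof -
  have "qpoch_inf ((q ^ m)\<^sup>2) ((q ^ (2 * m))\<^sup>2) = J q (2 * m) / J q (4 * m)"
    using qpoch_inf_power_double[of "2 * m"] m by (simp add: mult.commute flip: power_mult)
  moreover have "qpoch_inf ((q ^ m)\<^sup>2) ((q ^ (2 * m))\<^sup>2) =
      J q m / J q (2 * m) * qpoch_inf (- (q ^ m)) (q ^ (2 * m))"
    using qpoch_inf_square[OF norm_power_less_1[OF q], of "2 * m" "q ^ m"]
    by (simp add: m qpoch_inf_power_double)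
  ultimately show ?thesis
    using m J_nonzero[OF q, of m] J_nonzero[OF q, of "2 * m"] J_nonzero[OF q, of "4 * m"]
    by (simp add: field_simps power2_eq_square)
qed

lemma J_uminus_1: "J (- q) 1 = J q 2 ^ 3 / (J q 1 * J q 4)"
proof -
  have "J (- q) 1 = qpoch_inf (- q) (q\<^sup>2) * J q 2"
    using qpoch_inf_even_odd[of "- q" "- q"] q by (simp add: J_def power2_eq_square)
  then show ?thesis
    using qpoch_inf_neg_power_double[of 1] by (simp add: power2_eq_square power3_eq_cube)
qed

lemma jtheta_power_values:
  assumes "q \<noteq> 0"
  shows "jtheta q (q\<^sup>2) = (J q 1 / J q 2)\<^sup>2"
    and "jtheta (- q) (q\<^sup>2) = (J q 2 ^ 2 / (J q 1 * J q 4))\<^sup>2"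
    and "jtheta (- (q ^ 4)) (q ^ 8) = (J q 8 ^ 2 / (J q 4 * J q 16))\<^sup>2"
    and "jtheta (- 1) (q ^ 8) = 2 * (J q 16 / J q 8)\<^sup>2"
    and "jtheta (- (q\<^sup>2)) (q ^ 8) = J q 4 ^ 2 / (J q 2 * J q 8)"
proof -
  have d: "q\<^sup>2 / q = q" "q\<^sup>2 / (- q) = - q" "q ^ 8 / (- (q ^ 4)) = - (q ^ 4)"
    using assms by (simp_all add: field_simps power2_eq_square flip: power_add)
  show "jtheta q (q\<^sup>2) = (J q 1 / J q 2)\<^sup>2"
    unfolding jtheta_def d using qpoch_inf_power_double[of 1] by (simp add: power2_eq_square)
  show "jtheta (- q) (q\<^sup>2) = (J q 2 ^ 2 / (J q 1 * J q 4))\<^sup>2"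
    unfolding jtheta_def d using qpoch_inf_neg_power_double[of 1] by (simp add: power2_eq_square)
  show "jtheta (- (q ^ 4)) (q ^ 8) = (J q 8 ^ 2 / (J q 4 * J q 16))\<^sup>2"
    unfolding jtheta_def d using qpoch_inf_neg_power_double[of 4] by (simp add: power2_eq_square)
  show "jtheta (- 1) (q ^ 8) = 2 * (J q 16 / J q 8)\<^sup>2"
    using jtheta_neg_1[OF norm_power_less_1[OF q], of 8] qpoch_inf_neg_power_same[of 8] assms by simp
  show "jtheta (- (q\<^sup>2)) (q ^ 8) = J q 4 ^ 2 / (J q 2 * J q 8)"
    using jtheta_neg_quartic[OF norm_power_less_1[OF q], of 2] qpoch_inf_neg_power_double[of 2] assms
    by (simp flip: power_mult)
qed

text \<open>This is the theta dissection with base q^2 at x = -q. There the theta function equals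
  (J_2^2 / (J_1 J_4))^2 and so contains J_1^(-2), while all other factors have even index and are
  even functions of q.\<close>

lemma inverse_J1_squared:
  "1 / J q 1 ^ 2 = J q 8 ^ 5 / (J q 2 ^ 5 * J q 16 ^ 2)
     + 2 * q * (J q 4 ^ 2 * J q 16 ^ 2 / (J q 2 ^ 5 * J q 8))"
proof (cases "q = 0")
  case False
  have nz: "J q 1 \<noteq> 0" "J q 2 \<noteq> 0" "J q 4 \<noteq> 0" "J q 8 \<noteq> 0" "J q 16 \<noteq> 0"
    by (simp_all add: J_nonzero q)
  have n: "norm (q\<^sup>2) < 1" "q\<^sup>2 \<noteq> 0" "norm (q\<^sup>2) < norm (- q)" "norm (- q) < 1 / norm (q\<^sup>2)"
    using norm_square_annulus[OF q False] by simp_all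
  have e: "- (q\<^sup>2) * (- q)\<^sup>2 = - (q ^ 4)" "- (q\<^sup>2) / (- q)\<^sup>2 = - 1" "(q\<^sup>2) ^ 4 = q ^ 8" "(q\<^sup>2)\<^sup>2 = q ^ 4"
    using False by (simp_all flip: power_mult power_add)
  have *: "((J q 8 ^ 2 / (J q 4 * J q 16))\<^sup>2 + q * (2 * (J q 16 / J q 8)\<^sup>2)) * (J q 4 / J q 2)\<^sup>2 =
      J q 4 ^ 2 / (J q 2 * J q 8) * (J q 2 ^ 2 / (J q 1 * J q 4))\<^sup>2"
    using jtheta_dissection[OF n] qpoch_inf_neg_power_double[of 2] qpoch_inf_neg_power_same[of 2] False
    unfolding e by (simp add: jtheta_power_values)
  have "1 / J q 1 ^ 2 = J q 8 / J q 2 ^ 3 * (J q 4 ^ 2 / (J q 2 * J q 8) * (J q 2 ^ 2 / (J q 1 * J q 4))\<^sup>2)"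
    using nz by (simp add: divide_simps power_divide; algebra)
  also have "\<dots> = J q 8 ^ 5 / (J q 2 ^ 5 * J q 16 ^ 2)
     + 2 * q * (J q 4 ^ 2 * J q 16 ^ 2 / (J q 2 ^ 5 * J q 8))"
    unfolding *[symmetric] using nz by (simp add: divide_simps power_divide; algebra)
  finally show ?thesis .
qed auto

end

text \<open>In Ramanujan's notation this is phi(q^2)^2 = phi(-q)^2 + 4 q psi(q^4)^2, multiplied by
  J_2^4. It results from multiplying the dissections of \<open>1 / J w 1 ^ 2\<close> at the two
  square roots w and -w of q.\<close>

lemma J1_fourth_power_relation:
  assumes "norm q < 1"
  shows "J q 4 ^ 10 / J q 8 ^ 4 = J q 2 ^ 2 * J q 1 ^ 4 + 4 * q * (J q 2 ^ 4 * J q 8 ^ 4 / J q 4 ^ 2)"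
proof -
  define w where "w = csqrt q"
  have w: "w\<^sup>2 = q" by (simp add: w_def)
  have wn: "norm w < 1"
    using assms by (simp add: w_def)
  have Jw: "J w 2 = J q 1" "J w 4 = J q 2" "J w 8 = J q 4" "J w 16 = J q 8"
    using J_power[of w 2] by (simp_all add: w)
  have nz: "J q 1 \<noteq> 0" "J q 2 \<noteq> 0" "J q 4 \<noteq> 0" "J q 8 \<noteq> 0" "J w 1 \<noteq> 0"
    by (simp_all add: J_nonzero assms wn)
  define a b where "a = J q 4 ^ 5 / (J q 1 ^ 5 * J q 8 ^ 2)"
    and "b = J q 2 ^ 2 * J q 8 ^ 2 / (J q 1 ^ 5 * J q 4)"
  have 1: "1 / J w 1 ^ 2 = a + 2 * w * b"
    using inverse_J1_squared[OF wn] by (simp add: Jw a_def b_def)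
  have 2: "1 / J (- w) 1 ^ 2 = a - 2 * w * b"
    using inverse_J1_squared[of "- w"] wn by (simp add: Jw a_def b_def J_uminus_even)
  have "1 / J w 1 ^ 2 * (1 / J (- w) 1 ^ 2) = a\<^sup>2 - 4 * w\<^sup>2 * b\<^sup>2"
    unfolding 1 2 by (simp add: algebra_simps power2_eq_square)
  also have "1 / J w 1 ^ 2 * (1 / J (- w) 1 ^ 2) = J q 2 ^ 2 / J q 1 ^ 6"
    unfolding J_uminus_1[OF wn] Jw using nz by (simp add: divide_simps power_divide; algebra)
  finally have *: "J q 2 ^ 2 / J q 1 ^ 6 = a\<^sup>2 - 4 * w\<^sup>2 * b\<^sup>2" .
  have "J q 2 ^ 2 * J q 1 ^ 4 = J q 1 ^ 10 * (J q 2 ^ 2 / J q 1 ^ 6)"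
    using nz by (simp add: divide_simps power_divide; algebra)
  also have "\<dots> = J q 4 ^ 10 / J q 8 ^ 4 - 4 * q * (J q 2 ^ 4 * J q 8 ^ 4 / J q 4 ^ 2)"
    unfolding * w a_def b_def using nz by (simp add: divide_simps power_divide; algebra)
  finally show ?thesis by simp
qed

text \<open>Squaring the dissection of J_1^(-2) leaves two terms in the even part. The previous
  relation, taken at -q^2 so that its last term has the right sign, merges them into a single eta
  quotient.\<close>

lemma inverse_J1_fourth_power:
  assumes q: "norm q < 1"
  shows "1 / J q 1 ^ 4 = J q 4 ^ 14 / (J q 2 ^ 14 * J q 8 ^ 4)
     + 4 * q * (J q 4 ^ 2 * J q 8 ^ 4 / J q 2 ^ 10)"
proof -
  have nz: "J q 1 \<noteq> 0" "J q 2 \<noteq> 0" "J q 4 \<noteq> 0" "J q 8 \<noteq> 0" "J q 16 \<noteq> 0"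
    by (simp_all add: J_nonzero q)
  have q2: "norm (q\<^sup>2) < 1" using q by (simp add: norm_power_less_1)
  have J2: "J (- (q\<^sup>2)) 2 = J q 4" "J (- (q\<^sup>2)) 4 = J q 8" "J (- (q\<^sup>2)) 8 = J q 16"
    using J_power[of q 2] by (simp_all add: J_uminus_even)
  have "J (- (q\<^sup>2)) 1 = J q 4 ^ 3 / (J q 2 * J q 8)"
    using J_uminus_1[OF q2] J_power[of q 2] by simp
  then have "J q 8 ^ 10 / J q 16 ^ 4 =
      J q 4 ^ 2 * (J q 4 ^ 3 / (J q 2 * J q 8)) ^ 4 - 4 * q\<^sup>2 * (J q 4 ^ 4 * J q 16 ^ 4 / J q 8 ^ 2)"
    using J1_fourth_power_relation[of "- (q\<^sup>2)"] q2 by (simp add: J2)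
  moreover have "1 / J q 1 ^ 4 = (J q 8 ^ 5 / (J q 2 ^ 5 * J q 16 ^ 2)
     + 2 * q * (J q 4 ^ 2 * J q 16 ^ 2 / (J q 2 ^ 5 * J q 8)))\<^sup>2"
    unfolding inverse_J1_squared[OF q, symmetric] by (simp add: power_one_over flip: power_mult)
  moreover have "\<dots> = (J q 8 ^ 10 / J q 16 ^ 4) / J q 2 ^ 10
     + 4 * q\<^sup>2 * (J q 4 ^ 4 * J q 16 ^ 4 / J q 8 ^ 2) / J q 2 ^ 10
     + 4 * q * (J q 4 ^ 2 * J q 8 ^ 4 / J q 2 ^ 10)"
    using nz by (simp add: divide_simps power_divide; algebra)
  ultimately have "1 / J q 1 ^ 4 = J q 4 ^ 2 * (J q 4 ^ 3 / (J q 2 * J q 8)) ^ 4 / J q 2 ^ 10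
     + 4 * q * (J q 4 ^ 2 * J q 8 ^ 4 / J q 2 ^ 10)"
    by (simp add: diff_divide_distrib)
  also have "J q 4 ^ 2 * (J q 4 ^ 3 / (J q 2 * J q 8)) ^ 4 / J q 2 ^ 10 = J q 4 ^ 14 / (J q 2 ^ 14 * J q 8 ^ 4)"
    using nz by (simp add: power_divide power_mult_distrib flip: power_mult power_add)
  finally show ?thesis .
qed

section \<open>The third order mock theta function\<close>

text \<open>In this symmetric form both Pochhammer factors coincide for x = q and base q^2, which
  exhibits the square of the generating function of a single row.\<close>

lemma mock_g_sums:
  assumes q: "norm q < 1" "q \<noteq> 0" and x: "x \<noteq> 0" and nz: "jtheta x q \<noteq> 0"
  shows "(\<lambda>n. q ^ (n * (n + 1)) / (qpoch x q (n + 1) * qpoch (q / x) q (n + 1))) sums mock_g x q"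
proof -
  have "(\<lambda>n. inverse (jtheta x q) * mock_num_term x q n) sums (inverse (jtheta x q) * mock_num x q)"
    by (intro sums_mult mock_num_sums q)
  also have "inverse (jtheta x q) * mock_num x q = mock_g x q"
    using jtheta_mult_mock_g[OF q x nz] nz by (simp add: field_simps)
  also have "(\<lambda>n. inverse (jtheta x q) * mock_num_term x q n) =
      (\<lambda>n. q ^ (n * (n + 1)) / (qpoch x q (n + 1) * qpoch (q / x) q (n + 1)))"
  proof
    fix n
    have "jtheta x q = qpoch x q (n + 1) * qpoch (q / x) q (n + 1)
        * (qpoch_inf (x * q ^ (n + 1)) q * qpoch_inf (q ^ (n + 2) / x) q)"
      unfolding jtheta_def qpoch_inf_add[OF q(1), of x "n + 1"] qpoch_inf_add[OF q(1), of "q / x" "n + 1"]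
      by simp
    then show "inverse (jtheta x q) * mock_num_term x q n =
        q ^ (n * (n + 1)) / (qpoch x q (n + 1) * qpoch (q / x) q (n + 1))"
      using nz by (simp add: mock_num_term_def divide_simps)
  qed
  finally show ?thesis .
qed

text \<open>The theta identity with base q^2 at x = q, divided by its three theta factors. Of the
  mock terms on the right, the first is even in q and the second is odd, so only the eta quotient
  remains to be dissected.\<close>

lemma mock_g_three_term_identity:
  assumes q: "norm q < 1" and q_nz: "q \<noteq> 0"
  shows "q * mock_g q (q\<^sup>2) = - 1 + mock_g (- 1) (q ^ 8) - q ^ 3 * mock_g (- (q ^ 4)) (q ^ 8)
           + 1 / 2 * (J q 2 * J q 4 ^ 6 / (J q 1 ^ 2 * J q 8 ^ 4))"
proof -
  have nz: "J q 1 \<noteq> 0" "J q 2 \<noteq> 0" "J q 4 \<noteq> 0" "J q 8 \<noteq> 0" "J q 16 \<noteq> 0"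
    by (simp_all add: J_nonzero q)
  have n: "norm (q\<^sup>2) < 1" "q\<^sup>2 \<noteq> 0" "norm (q\<^sup>2) < norm q" "norm q < 1 / norm (q\<^sup>2)"
    using norm_square_annulus[OF q q_nz] by simp_all
  have q8: "norm (q ^ 8) < 1" "q ^ 8 \<noteq> 0" using q q_nz by (auto intro: norm_power_less_1)
  have e: "- (q\<^sup>2) * q\<^sup>2 = - (q ^ 4)" "- (q\<^sup>2) / q\<^sup>2 = - 1" "(q\<^sup>2) ^ 4 = q ^ 8" "q\<^sup>2 / q\<^sup>2 = 1"
    using q_nz by (simp_all flip: power_mult power_add)
  define A B j where "A = jtheta (- (q ^ 4)) (q ^ 8)" and "B = jtheta (- 1) (q ^ 8)"
    and "j = jtheta q (q\<^sup>2)"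
  have vals: "A = (J q 8 ^ 2 / (J q 4 * J q 16))\<^sup>2" "B = 2 * (J q 16 / J q 8)\<^sup>2"
    "j = (J q 1 / J q 2)\<^sup>2"
    using jtheta_power_values[OF q q_nz] by (simp_all add: A_def B_def j_def)
  then have ABj: "A \<noteq> 0" "B \<noteq> 0" "j \<noteq> 0" using nz by auto
  have K: "mock_num q (q\<^sup>2) = j * mock_g q (q\<^sup>2)" "mock_num (- 1) (q ^ 8) = B * mock_g (- 1) (q ^ 8)"
    "mock_num (- (q ^ 4)) (q ^ 8) = A * mock_g (- (q ^ 4)) (q ^ 8)"
    using jtheta_mult_mock_g[OF n(1,2), of q] jtheta_mult_mock_g[OF q8, of "- 1"]
      jtheta_mult_mock_g[OF q8, of "- (q ^ 4)"] ABj q_nz by (simp_all add: A_def B_def j_def)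
  have "A * B * (q * (j * mock_g q (q\<^sup>2)) + j) - 1 * j * A * (B * mock_g (- 1) (q ^ 8))
      + q\<^sup>2 * q * j * B * (A * mock_g (- (q ^ 4)) (q ^ 8)) = J q 2 * (J q 4 ^ 2 / (J q 2 * J q 8))\<^sup>2"
    using mock_num_theta_identity[OF n]
    unfolding e K A_def[symmetric] B_def[symmetric] j_def[symmetric] jtheta_power_values[OF q q_nz]
      qpoch_inf_power_eq_J .
  then have "(A * B * j) * (q * mock_g q (q\<^sup>2) - (- 1 + mock_g (- 1) (q ^ 8)
      - q ^ 3 * mock_g (- (q ^ 4)) (q ^ 8))) = J q 2 * (J q 4 ^ 2 / (J q 2 * J q 8))\<^sup>2"
    by (simp add: algebra_simps power2_eq_square power3_eq_cube)
  also have "\<dots> = (A * B * j) * (1 / 2 * (J q 2 * J q 4 ^ 6 / (J q 1 ^ 2 * J q 8 ^ 4)))"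
    unfolding vals using nz by (simp add: divide_simps power_divide; algebra)
  finally have "q * mock_g q (q\<^sup>2) - (- 1 + mock_g (- 1) (q ^ 8) - q ^ 3 * mock_g (- (q ^ 4)) (q ^ 8))
      = 1 / 2 * (J q 2 * J q 4 ^ 6 / (J q 1 ^ 2 * J q 8 ^ 4))"
    unfolding mult_cancel_left using ABj by simp
  then show ?thesis by (simp add: algebra_simps)
qed

section \<open>The generating function of odd Durfee symbols\<close>

lemma sum_list_odd_parity: "\<forall>x\<in>set xs. odd (x::nat) \<Longrightarrow> even (sum_list xs) \<longleftrightarrow> even (length xs)"
  by (induction xs) auto

text \<open>Modulo 2, s - t agrees with s + t, hence with the sum of all the odd entries; and 2D^2 +
  2D + 1 is odd.\<close>

lemma odd_rank_parity:
  assumes "S \<in> odd_durfee_symbols n"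
  shows "even (odd_rank S) \<longleftrightarrow> odd n"
proof -
  obtain D as bs where S: "S = (D, as, bs)" and rows: "odd_durfee_row D as" "odd_durfee_row D bs"
    and n: "n = sum_list as + sum_list bs + 2 * D\<^sup>2 + 2 * D + 1"
    using assms by (auto simp: odd_durfee_symbols_def)
  have "even (sum_list as) \<longleftrightarrow> even (length as)" "even (sum_list bs) \<longleftrightarrow> even (length bs)"
    using rows by (auto simp: odd_durfee_row_def sum_list_odd_parity)
  then show ?thesis
    by (auto simp: S n odd_rank_def)
qed

lemma N0_eq_card:
  shows "odd n \<Longrightarrow> N0 0 2 n = card (odd_durfee_symbols n)"
    and "even n \<Longrightarrow> N0 1 2 n = card (odd_durfee_symbols n)"
proof -
  assume "odd n"
  then have "[odd_rank S = 0] (mod 2)" if "S \<in> odd_durfee_symbols n" for S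
    using odd_rank_parity[OF that] by (simp add: cong_0_iff)
  then show "N0 0 2 n = card (odd_durfee_symbols n)"
    unfolding N0_def by (intro arg_cong[of _ _ card]) auto
next
  assume "even n"
  then have "[odd_rank S = 1] (mod 2)" if "S \<in> odd_durfee_symbols n" for S
    using odd_rank_parity[OF that] by (simp add: cong_def odd_iff_mod_2_eq_one)
  then show "N0 1 2 n = card (odd_durfee_symbols n)"
    unfolding N0_def by (intro arg_cong[of _ _ card]) auto
qed

lemma has_sum_product:
  fixes f :: "'a \<Rightarrow> complex" and g :: "'b \<Rightarrow> complex"
  assumes f: "(f has_sum a) A" and g: "(g has_sum b) B"
  shows "((\<lambda>(x, y). f x * g y) has_sum (a * b)) (A \<times> B)"
proof (rule has_sum_SigmaI)
  show "((\<lambda>y. case (x, y) of (x, y) \<Rightarrow> f x * g y) has_sum (f x * b)) B" for x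
    using has_sum_cmult_right[OF g, of "f x"] by simp
  show "((\<lambda>x. f x * b) has_sum (a * b)) A"
    by (rule has_sum_cmult_left[OF f])
  have "(\<lambda>x. norm (f x)) summable_on A" "(\<lambda>y. norm (g y)) summable_on B"
    using f g by (auto simp flip: summable_on_iff_abs_summable_on_complex simp: summable_on_def)
  then have "(\<lambda>z. norm (case z of (x, y) \<Rightarrow> f x * g y)) summable_on A \<times> B"
    by (subst Infinite_Sum.abs_summable_on_Sigma_iff)
       (auto simp: norm_mult abs_mult infsum_cmult_right'
          intro!: summable_on_cmult_right summable_on_cmult_left
          simp flip: summable_on_iff_abs_summable_on_real)
  then show "(\<lambda>(x, y). f x * g y) summable_on A \<times> B"
    by (rule abs_summable_summable)
qed

text \<open>The strict bound lets an induction start at 0, where only the empty row is left. Each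
  increase of the bound by 2, from an even value, admits exactly one new part.\<close>

definition odd_rows_below :: "nat \<Rightarrow> nat list set" where
  "odd_rows_below m = {xs. sorted_wrt (\<ge>) xs \<and> (\<forall>x\<in>set xs. odd x \<and> x < m)}"

text \<open>In a non-increasing row the copies of the largest admissible part form an initial block.
  Filtering by size recovers the remainder, and the length then recovers the multiplicity.\<close>

lemma odd_rows_below_Suc:
  "bij_betw (\<lambda>(k, xs). replicate k (2 * D + 1) @ xs)
     (UNIV \<times> odd_rows_below (2 * D)) (odd_rows_below (2 * Suc D))"
  unfolding bij_betw_def
proof
  let ?h = "\<lambda>(k, xs). replicate k (2 * D + 1) @ xs"
  show "inj_on ?h (UNIV \<times> odd_rows_below (2 * D))"
  proof (rule inj_onI, clarify)
    fix k l :: nat and xs ys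
    assume xs: "xs \<in> odd_rows_below (2 * D)" and ys: "ys \<in> odd_rows_below (2 * D)"
      and eq: "replicate k (2 * D + 1) @ xs = replicate l (2 * D + 1) @ ys"
    have f: "filter (\<lambda>x. x < 2 * D) zs = zs" "filter (\<lambda>x. \<not> x < 2 * D) zs = []"
      if "zs \<in> odd_rows_below (2 * D)" for zs
      using that by (auto simp: odd_rows_below_def intro!: filter_True filter_False)
    have "xs = ys"
      using arg_cong[OF eq, of "filter (\<lambda>x. x < 2 * D)"] by (simp add: f xs ys)
    then show "k = l \<and> xs = ys"
      using arg_cong[OF eq, of length] by simp
  qed
  show "?h ` (UNIV \<times> odd_rows_below (2 * D)) = odd_rows_below (2 * Suc D)"
  proof
    show "?h ` (UNIV \<times> odd_rows_below (2 * D)) \<subseteq> odd_rows_below (2 * Suc D)"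
    proof -
      have "sorted_wrt (\<ge>) (replicate k a)" for k and a :: nat
        by (induction k) auto
      then show ?thesis
        by (fastforce simp: odd_rows_below_def sorted_wrt_append)
    qed
    show "odd_rows_below (2 * Suc D) \<subseteq> ?h ` (UNIV \<times> odd_rows_below (2 * D))"
    proof
      fix xs
      assume "xs \<in> odd_rows_below (2 * Suc D)"
      then show "xs \<in> ?h ` (UNIV \<times> odd_rows_below (2 * D))"
      proof (induction xs)
        case Nil
        have "([] :: nat list) = ?h (0, [])" by simp
        then show ?case by (rule image_eqI) (simp add: odd_rows_below_def)
      next
        case (Cons x xs)
        have x: "odd x" "x < 2 * Suc D" "\<forall>y\<in>set xs. y \<le> x"
          and xs: "xs \<in> odd_rows_below (2 * Suc D)"
          using Cons.prems by (auto simp: odd_rows_below_def)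
        show ?case
        proof (cases "x = 2 * D + 1")
          case True
          obtain k ys where "xs = ?h (k, ys)" "ys \<in> odd_rows_below (2 * D)"
            using Cons.IH[OF xs] by auto
          then have "x # xs = ?h (Suc k, ys)" using True by simp
          with \<open>ys \<in> _\<close> show ?thesis by (intro image_eqI[of _ _ "(Suc k, ys)"]) auto
        next
          case False
          then have "x < 2 * D" using x by (elim oddE) auto
          then have "x # xs \<in> odd_rows_below (2 * D)"
            using Cons.prems x by (auto simp: odd_rows_below_def)
          then show ?thesis by (intro image_eqI[of _ _ "(0, x # xs)"]) auto
        qed
      qed
    qed
  qed
qed

lemma odd_rows_below_has_sum:
  assumes q: "norm q < 1"
  shows "((\<lambda>xs. q ^ sum_list xs) has_sum (1 / qpoch q (q\<^sup>2) D)) (odd_rows_below (2 * D))"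
proof (induction D)
  case 0
  have "odd_rows_below 0 = {[]}"
    by (auto simp: odd_rows_below_def)
  then show ?case
    using has_sum_finite[of "{[] :: nat list}" "\<lambda>xs. q ^ sum_list xs"] by simp
next
  case (Suc D)
  have n: "norm (q ^ (2 * D + 1)) < 1" using q by (intro norm_power_less_1) auto
  have geo: "((\<lambda>k. (q ^ (2 * D + 1)) ^ k) has_sum (1 / (1 - q ^ (2 * D + 1)))) UNIV"
    using n by (intro norm_summable_imp_has_sum geometric_sums)
      (simp_all add: norm_power summable_geometric)
  have "((\<lambda>(k, xs). (q ^ (2 * D + 1)) ^ k * q ^ sum_list xs) has_sum
      (1 / (1 - q ^ (2 * D + 1)) * (1 / qpoch q (q\<^sup>2) D))) (UNIV \<times> odd_rows_below (2 * D))"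
    by (rule has_sum_product[OF geo Suc.IH])
  moreover have "(q ^ m) ^ k * q ^ sum_list xs = q ^ sum_list (replicate k m @ xs)" for k m xs
    by (simp add: sum_list_replicate power_add mult.commute flip: power_mult)
  then have "(\<lambda>(k, xs). (q ^ (2 * D + 1)) ^ k * q ^ sum_list xs) =
      (\<lambda>z. q ^ sum_list (case z of (k, xs) \<Rightarrow> replicate k (2 * D + 1) @ xs))"
    by (simp only: case_prod_unfold)
  ultimately have "((\<lambda>z. q ^ sum_list (case z of (k, xs) \<Rightarrow> replicate k (2 * D + 1) @ xs)) has_sum
      (1 / (1 - q ^ (2 * D + 1)) * (1 / qpoch q (q\<^sup>2) D))) (UNIV \<times> odd_rows_below (2 * D))"
    by (simp only:)
  then have "((\<lambda>xs. q ^ sum_list xs) has_sum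
      (1 / (1 - q ^ (2 * D + 1)) * (1 / qpoch q (q\<^sup>2) D))) (odd_rows_below (2 * Suc D))"
    by (rule iffD1[OF has_sum_reindex_bij_betw[OF odd_rows_below_Suc, where f = "\<lambda>xs. q ^ sum_list xs"]])
  moreover have "qpoch q (q\<^sup>2) (Suc D) = qpoch q (q\<^sup>2) D * (1 - q ^ (2 * D + 1))"
    by (simp add: qpoch_Suc power_mult)
  ultimately show ?case by (simp add: mult.commute)
qed

lemma odd_durfee_row_iff: "odd_durfee_row D xs \<longleftrightarrow> xs \<in> odd_rows_below (2 * Suc D)"
proof -
  have "odd x \<and> x \<le> 2 * D + 1 \<longleftrightarrow> odd x \<and> x < 2 * Suc D" for x
    by auto
  then show ?thesis by (simp add: odd_durfee_row_def odd_rows_below_def)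
qed

text \<open>One absolutely convergent sum over all symbols is grouped in two ways: by
  \<open>D\<close>, which gives the series of \<open>mock_g_sums\<close>, and by the number
  represented, which gives the power series.\<close>

lemma odd_durfee_symbols_sums:
  assumes q: "norm q < 1"
  shows "(\<lambda>n. of_nat (card (odd_durfee_symbols n)) * q ^ n) sums (q * mock_g q (q\<^sup>2))"
proof (cases "q = 0")
  case True
  have "odd_durfee_symbols 0 = {}" by (simp add: odd_durfee_symbols_def)
  then have "(\<lambda>n. of_nat (card (odd_durfee_symbols n)) * q ^ n) = (\<lambda>n. 0)"
    using True by (auto simp: fun_eq_iff power_0_left)
  then show ?thesis using True by simp
next
  case q_nz: False
  define R where "R = (\<lambda>D. odd_rows_below (2 * Suc D))"
  define wt :: "nat \<times> nat list \<times> nat list \<Rightarrow> nat"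
    where "wt = (\<lambda>(D, as, bs). sum_list as + sum_list bs + 2 * D\<^sup>2 + 2 * D + 1)"
  define t where "t = (\<lambda>(w::complex) D. w ^ (2 * D\<^sup>2 + 2 * D + 1) * (1 / qpoch w (w\<^sup>2) (Suc D))\<^sup>2)"
  have inner: "((\<lambda>z. w ^ wt (D, z)) has_sum t w D) (R D \<times> R D)" if "norm w < 1" for w D
  proof -
    have "((\<lambda>z. w ^ (2 * D\<^sup>2 + 2 * D + 1) * (case z of (as, bs) \<Rightarrow> w ^ sum_list as * w ^ sum_list bs))
        has_sum (w ^ (2 * D\<^sup>2 + 2 * D + 1) * (1 / qpoch w (w\<^sup>2) (Suc D) * (1 / qpoch w (w\<^sup>2) (Suc D)))))
        (R D \<times> R D)"
      unfolding R_def by (intro has_sum_cmult_right has_sum_product odd_rows_below_has_sum that)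
    also have "(\<lambda>z. w ^ (2 * D\<^sup>2 + 2 * D + 1) * (case z of (as, bs) \<Rightarrow> w ^ sum_list as * w ^ sum_list bs))
        = (\<lambda>z. w ^ wt (D, z))"
      by (auto simp: fun_eq_iff wt_def power_add)
    finally show ?thesis by (simp add: t_def power2_eq_square)
  qed
  have t_sums: "t w sums (w * mock_g w (w\<^sup>2))" if w: "norm w < 1" "w \<noteq> 0" for w
  proof -
    have "jtheta w (w\<^sup>2) \<noteq> 0"
      using jtheta_power_values(1)[OF w] J_nonzero[OF w(1)] by simp
    then have "(\<lambda>n. w * ((w\<^sup>2) ^ (n * (n + 1)) / (qpoch w (w\<^sup>2) (n + 1) * qpoch (w\<^sup>2 / w) (w\<^sup>2) (n + 1))))
        sums (w * mock_g w (w\<^sup>2))"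
      by (intro sums_mult mock_g_sums norm_square_annulus w)
    moreover have d: "w\<^sup>2 / w = w" using w by (simp add: power2_eq_square)
    have e: "w * (w\<^sup>2) ^ (n * (n + 1)) = w ^ (2 * n\<^sup>2 + 2 * n + 1)" for n
    proof -
      have "2 * n\<^sup>2 + 2 * n + 1 = Suc (2 * (n * (n + 1)))"
        by (simp add: power2_eq_square algebra_simps)
      then show ?thesis by (simp only: power_Suc power_mult)
    qed
    have "t w = (\<lambda>n. w * ((w\<^sup>2) ^ (n * (n + 1)) / (qpoch w (w\<^sup>2) (n + 1) * qpoch (w\<^sup>2 / w) (w\<^sup>2) (n + 1))))"
      unfolding t_def d e[symmetric] by (simp add: fun_eq_iff power2_eq_square)
    ultimately show ?thesis by (simp only:)
  qed
  \<comment> \<open>The norms are the weights at the positive real base |q|. There the inner sums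
    are already known, and nonnegativity turns convergence of the iterated sum into
    summability.\<close>
  have abs: "(\<lambda>z. norm (q ^ wt z)) summable_on (SIGMA D:UNIV. R D \<times> R D)"
  proof -
    define r where "r = norm q"
    have r: "norm (complex_of_real r) < 1" "complex_of_real r \<noteq> 0"
      using q q_nz by (auto simp: r_def)
    define u where "u = (\<lambda>D. r ^ (2 * D\<^sup>2 + 2 * D + 1) * (1 / (\<Prod>k<Suc D. 1 - r * (r\<^sup>2) ^ k))\<^sup>2)"
    have u: "t (of_real r) = (\<lambda>D. complex_of_real (u D))"
      by (simp add: fun_eq_iff t_def u_def qpoch_def)
    have inner_r: "((\<lambda>z. r ^ wt (D, z)) has_sum u D) (R D \<times> R D)" for D
    proof -
      have "((\<lambda>z. complex_of_real (r ^ wt (D, z))) has_sum complex_of_real (u D)) (R D \<times> R D)"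
        using inner[OF r(1), of D] by (simp add: u)
      then show ?thesis by (simp only: has_sum_of_real_iff)
    qed
    have u_nonneg: "u D \<ge> 0" for D
      by (simp add: u_def r_def)
    have "summable u"
      using sums_summable[OF t_sums[OF r]] unfolding u by (simp only: summable_complex_of_real)
    then have "u summable_on UNIV"
      using u_nonneg by (simp add: summable_on_UNIV_nonneg_real_iff)
    then have "(\<lambda>z. r ^ wt z) summable_on (SIGMA D:UNIV. R D \<times> R D)"
      using inner_r by (intro summable_on_SigmaI[where g = u]) (auto simp: r_def)
    then show ?thesis by (simp add: norm_power r_def)
  qed
  obtain S where S: "((\<lambda>z. q ^ wt z) has_sum S) (SIGMA D:UNIV. R D \<times> R D)"
    using abs_summable_summable[OF abs] by (auto simp: summable_on_def)
  then have "(t q has_sum S) UNIV"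
    by (rule has_sum_SigmaD) (rule inner[OF q])
  then have "S = q * mock_g q (q\<^sup>2)"
    using has_sum_imp_sums t_sums[OF q q_nz] sums_unique2 by blast
  with S have total: "((\<lambda>z. q ^ wt z) has_sum (q * mock_g q (q\<^sup>2))) (SIGMA D:UNIV. R D \<times> R D)"
    by simp
  have "bij_betw snd (Sigma UNIV odd_durfee_symbols) (SIGMA D:UNIV. R D \<times> R D)"
    by (rule bij_betw_byWitness[where f' = "\<lambda>z. (wt z, z)"])
       (auto simp: odd_durfee_symbols_def odd_durfee_row_iff R_def wt_def)
  then have "((\<lambda>z. q ^ wt (snd z)) has_sum (q * mock_g q (q\<^sup>2))) (Sigma UNIV odd_durfee_symbols)"
    using has_sum_reindex_bij_betw[where f = "\<lambda>z. q ^ wt z"] total by blast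
  then have "((\<lambda>n. of_nat (card (odd_durfee_symbols n)) * q ^ n) has_sum (q * mock_g q (q\<^sup>2))) UNIV"
  proof (rule has_sum_SigmaD)
    fix n
    have "((\<lambda>y. q ^ wt (snd (n, y))) has_sum (\<Sum>y\<in>odd_durfee_symbols n. q ^ wt (snd (n, y))))
        (odd_durfee_symbols n)"
      by (rule has_sum_finite[OF finite_odd_durfee_symbols])
    also have "(\<Sum>y\<in>odd_durfee_symbols n. q ^ wt (snd (n, y))) = (\<Sum>y\<in>odd_durfee_symbols n. q ^ n)"
      by (intro sum.cong) (auto simp: odd_durfee_symbols_def wt_def)
    finally show "((\<lambda>y. q ^ wt (snd (n, y))) has_sum (of_nat (card (odd_durfee_symbols n)) * q ^ n))
        (odd_durfee_symbols n)"
      by simp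
  qed
  then show ?thesis by (rule has_sum_imp_sums)
qed

section \<open>Extracting arithmetic progressions\<close>

text \<open>\<open>U\<close> and \<open>V\<close> are the same for both square roots of
  \<open>q\<close>, so half the sum and half the difference of the two instances isolate one parity
  each. The odd part is obtained through a division by \<open>z\<close>.\<close>

lemma sums_even_odd_parts:
  fixes a :: "nat \<Rightarrow> complex"
  assumes sums: "\<And>z. z\<^sup>2 = q \<Longrightarrow> (\<lambda>n. a n * z ^ n) sums (U + z * V)"
  shows "(\<lambda>n. a (2 * n) * q ^ n) sums U"
    and "q \<noteq> 0 \<Longrightarrow> (\<lambda>n. a (2 * n + 1) * q ^ n) sums V"
proof -
  define z where "z = csqrt q"
  have z: "z\<^sup>2 = q" by (simp add: z_def)
  have pos: "(\<lambda>n. a n * z ^ n) sums (U + z * V)" and neg: "(\<lambda>n. a n * (- z) ^ n) sums (U - z * V)"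
    using sums[of z] sums[of "- z"] z by simp_all
  have odd: "odd n" if "n \<notin> range (\<lambda>k::nat. 2 * k)" for n
    using that by (auto elim!: evenE)
  have even: "even n" if "n \<notin> range (\<lambda>k::nat. Suc (2 * k))" for n
    using that by (metis Suc_eq_plus1 oddE rangeI)
  have zp: "z ^ (2 * n) = q ^ n" for n by (simp add: power_mult z)
  have "(\<lambda>n. (a n * z ^ n + a n * (- z) ^ n) / 2) sums ((U + z * V + (U - z * V)) / 2)"
    by (intro sums_divide sums_add pos neg)
  then have "(\<lambda>n. (a (2 * n) * z ^ (2 * n) + a (2 * n) * (- z) ^ (2 * n)) / 2) sums U"
    by (subst sums_mono_reindex[of "\<lambda>n. 2 * n" "\<lambda>n. (a n * z ^ n + a n * (- z) ^ n) / 2"])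
       (auto simp: strict_mono_def dest!: odd)
  moreover have "(a (2 * n) * z ^ (2 * n) + a (2 * n) * (- z) ^ (2 * n)) / 2 = a (2 * n) * q ^ n" for n
    by (simp add: zp)
  ultimately show "(\<lambda>n. a (2 * n) * q ^ n) sums U"
    by (simp only:)
  assume "q \<noteq> 0"
  then have "z \<noteq> 0" using z by auto
  have "(\<lambda>n. (a n * z ^ n - a n * (- z) ^ n) / (2 * z)) sums ((U + z * V - (U - z * V)) / (2 * z))"
    by (intro sums_divide sums_diff pos neg)
  then have "(\<lambda>n. (a (2 * n + 1) * z ^ (2 * n + 1) - a (2 * n + 1) * (- z) ^ (2 * n + 1)) / (2 * z)) sums V"
    using \<open>z \<noteq> 0\<close>
    by (subst sums_mono_reindex[of "\<lambda>n. 2 * n + 1" "\<lambda>n. (a n * z ^ n - a n * (- z) ^ n) / (2 * z)"])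
       (auto simp: strict_mono_def dest!: even)
  moreover have "(a (2 * n + 1) * z ^ (2 * n + 1) - a (2 * n + 1) * (- z) ^ (2 * n + 1)) / (2 * z)
      = a (2 * n + 1) * q ^ n" for n
    using \<open>z \<noteq> 0\<close> by (simp add: zp)
  ultimately show "(\<lambda>n. a (2 * n + 1) * q ^ n) sums V"
    by (simp only:)
qed

text \<open>This closed form and the next one are named because they recur: they are split again at
  the next level, and they come back inside the series for 8n + 7 and 8n + 3.\<close>

definition durfee_even :: "complex \<Rightarrow> complex" where
  "durfee_even q = - 1 + mock_g (- 1) (q ^ 4) + 1 / 2 * (J q 2 ^ 6 * J q 4 / (J q 1 ^ 4 * J q 8 ^ 2))"

definition durfee_odd :: "complex \<Rightarrow> complex" where
  "durfee_odd q = - q * mock_g (- (q ^ 2)) (q ^ 4) + J q 2 ^ 8 * J q 8 ^ 2 / (J q 1 ^ 4 * J q 4 ^ 5)"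

section \<open>Even and odd parts of the closed forms in a square root z of q\<close>

context
  fixes q z :: complex
  assumes q: "norm q < 1" and q_nz: "q \<noteq> 0" and z: "z\<^sup>2 = q"
begin

lemma sqrt_norm: "norm z < 1"
proof -
  have "norm z ^ 2 < 1" using q unfolding z[symmetric] by (simp add: norm_power)
  then show ?thesis by (simp add: abs_square_less_1)
qed

lemma sqrt_nonzero: "z \<noteq> 0"
  using z q_nz by auto

lemma J_sqrt: "J z 2 = J q 1" "J z 4 = J q 2" "J z 8 = J q 4" "J z 16 = J q 8"
  using J_power[of z 2] by (simp_all add: z)

lemma power_sqrt: "z ^ 4 = q\<^sup>2" "z ^ 8 = q ^ 4" "z ^ 3 = z * q"
  using power_mult[of z 2 2] power_mult[of z 2 4] by (simp_all add: z power3_eq_cube power2_eq_square flip: z)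

lemma J_nz: "J q 1 \<noteq> 0" "J q 2 \<noteq> 0" "J q 4 \<noteq> 0" "J q 8 \<noteq> 0"
  by (simp_all add: J_nonzero q)

lemma inverse_J1_squared_sqrt:
  "1 / J z 1 ^ 2 = J q 4 ^ 5 / (J q 1 ^ 5 * J q 8 ^ 2)
     + z * (2 * (J q 2 ^ 2 * J q 8 ^ 2 / (J q 1 ^ 5 * J q 4)))"
  using inverse_J1_squared[OF sqrt_norm] by (simp add: J_sqrt)

lemma inverse_J1_fourth_power_sqrt:
  "1 / J z 1 ^ 4 = J q 2 ^ 14 / (J q 1 ^ 14 * J q 4 ^ 4)
     + z * (4 * (J q 2 ^ 2 * J q 4 ^ 4 / J q 1 ^ 10))"
  using inverse_J1_fourth_power[OF sqrt_norm] by (simp add: J_sqrt)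

lemma mock_g_sqrt: "z * mock_g z q = durfee_even q + z * durfee_odd q"
proof -
  have "z * mock_g z q = - 1 + mock_g (- 1) (q ^ 4) - z * q * mock_g (- (q\<^sup>2)) (q ^ 4)
      + 1 / 2 * (J q 1 * J q 2 ^ 6 / J q 4 ^ 4 * (1 / J z 1 ^ 2))"
    using mock_g_three_term_identity[OF sqrt_norm sqrt_nonzero]
    unfolding z J_sqrt power_sqrt by (simp add: mult_ac)
  also have "\<dots> = durfee_even q + z * durfee_odd q"
    unfolding inverse_J1_squared_sqrt durfee_even_def durfee_odd_def
    using J_nz by (simp add: divide_simps; algebra)
  finally show ?thesis .
qed

text \<open>The mock term depends on \<open>z\<close> only through z^4 = q^2, so it stays entirely
  in the even part; the odd part is a pure eta quotient.\<close>

lemma durfee_even_sqrt: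
  "durfee_even z = (- 1 + mock_g (- 1) (q\<^sup>2) + 1 / 2 * (J q 2 ^ 15 / (J q 1 ^ 8 * J q 4 ^ 6)))
     + z * (2 * (J q 2 ^ 3 * J q 4 ^ 2 / J q 1 ^ 4))"
proof -
  have "durfee_even z = - 1 + mock_g (- 1) (q\<^sup>2) + 1 / 2 * (J q 1 ^ 6 * J q 2 / J q 4 ^ 2 * (1 / J z 1 ^ 4))"
    unfolding durfee_even_def J_sqrt power_sqrt by (simp add: mult_ac)
  also have "\<dots> = (- 1 + mock_g (- 1) (q\<^sup>2) + 1 / 2 * (J q 2 ^ 15 / (J q 1 ^ 8 * J q 4 ^ 6)))
     + z * (2 * (J q 2 ^ 3 * J q 4 ^ 2 / J q 1 ^ 4))"
    unfolding inverse_J1_fourth_power_sqrt using J_nz by (simp add: divide_simps; algebra)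
  finally show ?thesis .
qed

text \<open>Here the mock term carries a factor \<open>z\<close> and otherwise depends on q alone,
  so it goes entirely to the odd part and the even part is a pure eta quotient.\<close>

lemma durfee_odd_sqrt:
  "durfee_odd z = J q 2 ^ 9 / (J q 1 ^ 6 * J q 4 ^ 2)
     + z * (- mock_g (- q) (q\<^sup>2) + 4 * (J q 4 ^ 6 / (J q 1 ^ 2 * J q 2 ^ 3)))"
proof -
  have "durfee_odd z = - z * mock_g (- q) (q\<^sup>2) + J q 1 ^ 8 * J q 4 ^ 2 / J q 2 ^ 5 * (1 / J z 1 ^ 4)"
    unfolding durfee_odd_def J_sqrt power_sqrt z by (simp add: mult_ac)
  also have "\<dots> = J q 2 ^ 9 / (J q 1 ^ 6 * J q 4 ^ 2)
     + z * (- mock_g (- q) (q\<^sup>2) + 4 * (J q 4 ^ 6 / (J q 1 ^ 2 * J q 2 ^ 3)))"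
    unfolding inverse_J1_fourth_power_sqrt using J_nz by (simp add: divide_simps; algebra)
  finally show ?thesis .
qed

text \<open>This makes the dissections multiplicative: J_1^(-6) and J_1^(-8) are handled as products
  of those of J_1^(-2) and J_1^(-4).\<close>

lemma mult_sqrt: "(a + z * b) * (c + z * d) = (a * c + q * (b * d)) + z * (a * d + b * c)"
  by (simp add: z[symmetric] power2_eq_square algebra_simps)

lemma eta_4n_plus_1_sqrt:
  "J z 2 ^ 9 / (J z 1 ^ 6 * J z 4 ^ 2) =
     (J q 2 ^ 12 * J q 4 / (J q 1 ^ 10 * J q 8 ^ 2) + 8 * q * (J q 2 ^ 2 * J q 4 ^ 3 * J q 8 ^ 2 / J q 1 ^ 6))
     + z * (2 * (J q 2 ^ 14 * J q 8 ^ 2 / (J q 1 ^ 10 * J q 4 ^ 5) + 2 * (J q 4 ^ 9 / (J q 1 ^ 6 * J q 8 ^ 2))))"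
proof -
  have "J z 2 ^ 9 / (J z 1 ^ 6 * J z 4 ^ 2) = J q 1 ^ 9 / J q 2 ^ 2 * ((1 / J z 1 ^ 2) * (1 / J z 1 ^ 4))"
    unfolding J_sqrt by (simp add: mult_ac flip: power_add)
  also have "\<dots> = (J q 2 ^ 12 * J q 4 / (J q 1 ^ 10 * J q 8 ^ 2)
        + 8 * q * (J q 2 ^ 2 * J q 4 ^ 3 * J q 8 ^ 2 / J q 1 ^ 6))
     + z * (2 * (J q 2 ^ 14 * J q 8 ^ 2 / (J q 1 ^ 10 * J q 4 ^ 5) + 2 * (J q 4 ^ 9 / (J q 1 ^ 6 * J q 8 ^ 2))))"
    unfolding inverse_J1_squared_sqrt inverse_J1_fourth_power_sqrt mult_sqrt
    using J_nz by (simp add: divide_simps; algebra)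
  finally show ?thesis .
qed

lemma eta_4n_plus_2_sqrt:
  "2 * (J z 2 ^ 3 * J z 4 ^ 2 / J z 1 ^ 4) =
     2 * (J q 2 ^ 16 / (J q 1 ^ 11 * J q 4 ^ 4)) + z * (8 * (J q 2 ^ 4 * J q 4 ^ 4 / J q 1 ^ 7))"
proof -
  have "2 * (J z 2 ^ 3 * J z 4 ^ 2 / J z 1 ^ 4) = 2 * (J q 1 ^ 3 * J q 2 ^ 2 * (1 / J z 1 ^ 4))"
    unfolding J_sqrt by simp
  also have "\<dots> = 2 * (J q 2 ^ 16 / (J q 1 ^ 11 * J q 4 ^ 4)) + z * (8 * (J q 2 ^ 4 * J q 4 ^ 4 / J q 1 ^ 7))"
    unfolding inverse_J1_fourth_power_sqrt using J_nz by (simp add: divide_simps; algebra)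
  finally show ?thesis .
qed

lemma gf_4n_sqrt:
  "- 1 + mock_g (- 1) (z\<^sup>2) + 1 / 2 * (J z 2 ^ 15 / (J z 1 ^ 8 * J z 4 ^ 6)) =
     (- 1 + mock_g (- 1) q + 1 / 2 * (J q 2 ^ 22 / (J q 1 ^ 13 * J q 4 ^ 8))
          + 8 * q * (J q 4 ^ 8 / (J q 1 ^ 5 * J q 2 ^ 2)))
     + z * (4 * (J q 2 ^ 10 / J q 1 ^ 9))"
proof -
  have "1 / 2 * (J z 2 ^ 15 / (J z 1 ^ 8 * J z 4 ^ 6)) =
      1 / 2 * (J q 1 ^ 15 / J q 2 ^ 6 * ((1 / J z 1 ^ 4) * (1 / J z 1 ^ 4)))"
    unfolding J_sqrt by (simp add: mult_ac flip: power_add)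
  also have "\<dots> = 1 / 2 * (J q 2 ^ 22 / (J q 1 ^ 13 * J q 4 ^ 8))
          + 8 * q * (J q 4 ^ 8 / (J q 1 ^ 5 * J q 2 ^ 2)) + z * (4 * (J q 2 ^ 10 / J q 1 ^ 9))"
    unfolding inverse_J1_fourth_power_sqrt mult_sqrt
    using J_nz by (simp add: divide_simps; algebra)
  finally show ?thesis unfolding z by (simp add: algebra_simps)
qed

text \<open>Here \<open>mock_g (- z) (z\<^sup>2)\<close> is again the generating function itself, at \<open>- z\<close>, so its even and
  odd parts are the closed forms already found.\<close>

lemma gf_4n_plus_3_sqrt:
  assumes "z * mock_g (- z) q = - durfee_even q + z * durfee_odd q"
  shows "- mock_g (- z) (z\<^sup>2) + 4 * (J z 4 ^ 6 / (J z 1 ^ 2 * J z 2 ^ 3)) =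
     (- durfee_odd q + 4 * (J q 2 ^ 6 * J q 4 ^ 5 / (J q 1 ^ 8 * J q 8 ^ 2)))
     + z * (inverse q * durfee_even q + 8 * (J q 2 ^ 8 * J q 8 ^ 2 / (J q 1 ^ 8 * J q 4)))"
proof -
  have "4 * (J z 4 ^ 6 / (J z 1 ^ 2 * J z 2 ^ 3)) = 4 * (J q 2 ^ 6 / J q 1 ^ 3 * (1 / J z 1 ^ 2))"
    unfolding J_sqrt by (simp add: mult_ac)
  also have "\<dots> = 4 * (J q 2 ^ 6 * J q 4 ^ 5 / (J q 1 ^ 8 * J q 8 ^ 2))
      + z * (8 * (J q 2 ^ 8 * J q 8 ^ 2 / (J q 1 ^ 8 * J q 4)))"
    unfolding inverse_J1_squared_sqrt using J_nz by (simp add: divide_simps; algebra)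
  moreover have "mock_g (- z) q = durfee_odd q - z * (inverse q * durfee_even q)"
  proof -
    have "mock_g (- z) q = (z * mock_g (- z) q) / z" using sqrt_nonzero by simp
    also have "\<dots> = durfee_odd q - z * (inverse (z\<^sup>2) * durfee_even q)"
      unfolding assms using sqrt_nonzero by (simp add: field_simps power2_eq_square)
    finally show ?thesis unfolding z .
  qed
  ultimately show ?thesis unfolding z by (simp add: algebra_simps)
qed

end


section \<open>The fourteen series for nonzero q\<close>

lemma gf_even:
  assumes q: "norm q < 1" "q \<noteq> 0"
  shows "(\<lambda>n. of_nat (N0 1 2 (2 * n)) * q ^ n) sums durfee_even q"
proof -
  have "(\<lambda>n. of_nat (card (odd_durfee_symbols n)) * z ^ n) sums (durfee_even q + z * durfee_odd q)"
    if "z\<^sup>2 = q" for z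
    using odd_durfee_symbols_sums[OF sqrt_norm[OF q that]] mock_g_sqrt[OF q that] by (simp add: that)
  from sums_even_odd_parts(1)[OF this] show ?thesis
    by (simp add: N0_eq_card)
qed

lemma gf_odd:
  assumes q: "norm q < 1" "q \<noteq> 0"
  shows "(\<lambda>n. of_nat (N0 0 2 (2 * n + 1)) * q ^ n) sums durfee_odd q"
proof -
  have "(\<lambda>n. of_nat (card (odd_durfee_symbols n)) * z ^ n) sums (durfee_even q + z * durfee_odd q)"
    if "z\<^sup>2 = q" for z
    using odd_durfee_symbols_sums[OF sqrt_norm[OF q that]] mock_g_sqrt[OF q that] by (simp add: that)
  from sums_even_odd_parts(2)[OF this q(2)] show ?thesis
    by (simp add: N0_eq_card)
qed

text \<open>One halving step: the class of j modulo k splits into the classes of j and k + j modulo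
  2k. The series is evaluated at the square roots of \<open>q\<close>, which is why
  \<open>gf\<close> ranges over the whole punctured disc.\<close>

lemma gf_even_odd_parts:
  fixes q :: complex
  assumes q: "norm q < 1" "q \<noteq> 0"
    and gf: "\<And>w. norm w < 1 \<Longrightarrow> w \<noteq> 0 \<Longrightarrow> (\<lambda>n. of_nat (N0 a M (k * n + j)) * w ^ n) sums G w"
    and G: "\<And>z. z\<^sup>2 = q \<Longrightarrow> G z = U + z * V"
  shows "(\<lambda>n. of_nat (N0 a M (2 * k * n + j)) * q ^ n) sums U"
    and "(\<lambda>n. of_nat (N0 a M (2 * k * n + (k + j))) * q ^ n) sums V"
proof -
  have s: "(\<lambda>n. of_nat (N0 a M (k * n + j)) * z ^ n) sums (U + z * V)" if "z\<^sup>2 = q" for z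
    using gf[OF sqrt_norm[OF q that] sqrt_nonzero[OF q that]] unfolding G[OF that] .
  have "k * (2 * n) + j = 2 * k * n + j" "k * (2 * n + 1) + j = 2 * k * n + (k + j)" for n
    by (simp_all add: algebra_simps)
  then show "(\<lambda>n. of_nat (N0 a M (2 * k * n + j)) * q ^ n) sums U"
    and "(\<lambda>n. of_nat (N0 a M (2 * k * n + (k + j))) * q ^ n) sums V"
    using sums_even_odd_parts[where q = q and a = "\<lambda>n. of_nat (N0 a M (k * n + j))", OF s] q(2)
    by (simp_all only: not_False_eq_True)
qed

context
  fixes q :: complex
  assumes q: "norm q < 1" and q_nz: "q \<noteq> 0"
begin

lemma gf_4n_and_4n_plus_2:
  "(\<lambda>n. of_nat (N0 1 2 (4 * n)) * q ^ n) sums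
     (- 1 + mock_g (- 1) (q\<^sup>2) + 1 / 2 * (J q 2 ^ 15 / (J q 1 ^ 8 * J q 4 ^ 6)))"
  "(\<lambda>n. of_nat (N0 1 2 (4 * n + 2)) * q ^ n) sums (2 * (J q 2 ^ 3 * J q 4 ^ 2 / J q 1 ^ 4))"
  using gf_even_odd_parts[where k = 2 and j = 0 and G = durfee_even, OF q q_nz _ durfee_even_sqrt[OF q q_nz]]
    gf_even by simp_all

lemma gf_4n_plus_1_and_4n_plus_3:
  "(\<lambda>n. of_nat (N0 0 2 (4 * n + 1)) * q ^ n) sums (J q 2 ^ 9 / (J q 1 ^ 6 * J q 4 ^ 2))"
  "(\<lambda>n. of_nat (N0 0 2 (4 * n + 3)) * q ^ n) sums
     (- mock_g (- q) (q\<^sup>2) + 4 * (J q 4 ^ 6 / (J q 1 ^ 2 * J q 2 ^ 3)))"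
  using gf_even_odd_parts[where k = 2 and j = 1 and G = durfee_odd, OF q q_nz gf_odd durfee_odd_sqrt[OF q q_nz]]
  by simp_all

end

context
  fixes q :: complex
  assumes q: "norm q < 1" and q_nz: "q \<noteq> 0"
begin

text \<open>The series modulo 4 are now needed at the square roots of \<open>q\<close>, so they had
  to be generalized over their base before this point.\<close>

lemma gf_8n_plus_1_and_8n_plus_5:
  "(\<lambda>n. of_nat (N0 0 2 (8 * n + 1)) * q ^ n) sums
     (J q 2 ^ 12 * J q 4 / (J q 1 ^ 10 * J q 8 ^ 2)
       + 8 * q * (J q 2 ^ 2 * J q 4 ^ 3 * J q 8 ^ 2 / J q 1 ^ 6))"
  "(\<lambda>n. of_nat (N0 0 2 (8 * n + 5)) * q ^ n) sums
     (2 * (J q 2 ^ 14 * J q 8 ^ 2 / (J q 1 ^ 10 * J q 4 ^ 5) + 2 * (J q 4 ^ 9 / (J q 1 ^ 6 * J q 8 ^ 2))))"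
  using gf_even_odd_parts[where k = 4 and j = 1,
      OF q q_nz gf_4n_plus_1_and_4n_plus_3(1) eta_4n_plus_1_sqrt[OF q q_nz]]
  by simp_all

lemma gf_8n_plus_3_and_8n_plus_7:
  "(\<lambda>n. of_nat (N0 0 2 (8 * n + 3)) * q ^ n) sums
     (- durfee_odd q + 4 * (J q 2 ^ 6 * J q 4 ^ 5 / (J q 1 ^ 8 * J q 8 ^ 2)))"
  "(\<lambda>n. of_nat (N0 0 2 (8 * n + 7)) * q ^ n) sums
     (inverse q * durfee_even q + 8 * (J q 2 ^ 8 * J q 8 ^ 2 / (J q 1 ^ 8 * J q 4)))"
proof -
  \<comment> \<open>Since \<open>- z\<close> is the other square root of \<open>q\<close>,
    \<open>mock_g_sqrt\<close> applies to it with the same even and odd parts.\<close>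
  have "z * mock_g (- z) q = - durfee_even q + z * durfee_odd q" if "z\<^sup>2 = q" for z
    using mock_g_sqrt[OF q q_nz, of "- z"] that by (simp add: algebra_simps)
  note gf_even_odd_parts[where k = 4 and j = 3,
      OF q q_nz gf_4n_plus_1_and_4n_plus_3(2) gf_4n_plus_3_sqrt[OF q q_nz _ this]]
  then show "(\<lambda>n. of_nat (N0 0 2 (8 * n + 3)) * q ^ n) sums
     (- durfee_odd q + 4 * (J q 2 ^ 6 * J q 4 ^ 5 / (J q 1 ^ 8 * J q 8 ^ 2)))"
    and "(\<lambda>n. of_nat (N0 0 2 (8 * n + 7)) * q ^ n) sums
     (inverse q * durfee_even q + 8 * (J q 2 ^ 8 * J q 8 ^ 2 / (J q 1 ^ 8 * J q 4)))"
    by simp_all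
qed

lemma gf_8n_and_8n_plus_4:
  "(\<lambda>n. of_nat (N0 1 2 (8 * n)) * q ^ n) sums
     (- 1 + mock_g (- 1) q + 1 / 2 * (J q 2 ^ 22 / (J q 1 ^ 13 * J q 4 ^ 8))
       + 8 * q * (J q 4 ^ 8 / (J q 1 ^ 5 * J q 2 ^ 2)))"
  "(\<lambda>n. of_nat (N0 1 2 (8 * n + 4)) * q ^ n) sums (4 * (J q 2 ^ 10 / J q 1 ^ 9))"
  using gf_even_odd_parts[where k = 4 and j = 0, OF q q_nz _ gf_4n_sqrt[OF q q_nz]]
    gf_4n_and_4n_plus_2(1) by simp_all

lemma gf_8n_plus_2_and_8n_plus_6:
  "(\<lambda>n. of_nat (N0 1 2 (8 * n + 2)) * q ^ n) sums (2 * (J q 2 ^ 16 / (J q 1 ^ 11 * J q 4 ^ 4)))"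
  "(\<lambda>n. of_nat (N0 1 2 (8 * n + 6)) * q ^ n) sums (8 * (J q 2 ^ 4 * J q 4 ^ 4 / J q 1 ^ 7))"
  using gf_even_odd_parts[where k = 4 and j = 2,
      OF q q_nz gf_4n_and_4n_plus_2(2) eta_4n_plus_2_sqrt[OF q q_nz]]
  by simp_all

end

section \<open>The value at the origin\<close>

lemma isCont_J_zero:
  assumes "m > 0"
  shows "isCont (\<lambda>q. J q m) 0"
proof -
  have "((\<lambda>q. J q m - 1) \<longlongrightarrow> 0) (at 0)"
  proof (rule Lim_null_comparison)
    have "norm (J q m - 1) \<le> exp (norm (q ^ m) / (1 - norm (q ^ m))) - 1" if "norm q < 1" for q
      unfolding J_def by (rule norm_qpoch_inf_minus_1_le[OF norm_power_less_1[OF that assms]])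
    then show "\<forall>\<^sub>F q in at 0. norm (J q m - 1) \<le> exp (norm (q ^ m) / (1 - norm (q ^ m))) - 1"
      by (auto simp: eventually_at intro!: exI[of _ 1])
    show "((\<lambda>q::complex. exp (norm (q ^ m) / (1 - norm (q ^ m))) - 1) \<longlongrightarrow> 0) (at 0)"
      using assms by (auto intro!: tendsto_eq_intros simp: power_0_left)
  qed
  then show ?thesis
    using assms by (simp add: isCont_def flip: Lim_null)
qed

text \<open>The constant coefficient is the limit of the closed form along nonzero q, so continuity
  extends each identity to the origin.\<close>

lemma sums_at_zero:
  fixes a :: "nat \<Rightarrow> complex"
  assumes "\<And>q. norm q < 1 \<Longrightarrow> q \<noteq> 0 \<Longrightarrow> (\<lambda>n. a n * q ^ n) sums G q" "isCont G 0"
  shows "(\<lambda>n. a n * 0 ^ n) sums G 0"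
proof -
  have "(G \<longlongrightarrow> a 0) (at 0)"
    by (rule powser_limit_0_strong[of 1]) (use assms(1) in auto)
  then have "a 0 = G 0"
    using assms(2) LIM_unique by (auto simp: isCont_def)
  then show ?thesis using powser_sums_zero[of a] by simp
qed

lemma mock_g_neg_1_0: "mock_g (- 1) 0 = 1 / 2"
proof -
  have "(\<lambda>n. (0::complex) ^ (n\<^sup>2) / (qpoch (- 1) 0 (n + 1) * qpoch (0 / - 1) 0 n)) =
      (\<lambda>n. if n = 0 then 1 / 2 else 0)"
    by (auto simp: fun_eq_iff qpoch_Suc)
  then show ?thesis
    using sums_unique[OF sums_single[of 0 "\<lambda>_. 1 / 2 :: complex"]] by (simp add: mock_g_def)
qed

theorem theorem3p1:
  fixes q :: complex
  assumes "norm q < 1"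
  shows
    "(q \<noteq> 0 \<longrightarrow> (\<lambda>n. of_nat (N0 0 2 (2 * n + 1)) * q ^ n) sums
        (- q * mock_g (- (q ^ 2)) (q ^ 4) + J q 2 ^ 8 * J q 8 ^ 2 / (J q 1 ^ 4 * J q 4 ^ 5)))
     \<and> (\<lambda>n. of_nat (N0 0 2 (4 * n + 1)) * q ^ n) sums
        (J q 2 ^ 9 / (J q 1 ^ 6 * J q 4 ^ 2))
     \<and> (q \<noteq> 0 \<longrightarrow> (\<lambda>n. of_nat (N0 0 2 (4 * n + 3)) * q ^ n) sums
        (- mock_g (- q) (q ^ 2) + 4 * (J q 4 ^ 6 / (J q 1 ^ 2 * J q 2 ^ 3))))
     \<and> (\<lambda>n. of_nat (N0 1 2 (2 * n)) * q ^ n) sums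
        (- 1 + mock_g (- 1) (q ^ 4) + 1 / 2 * (J q 2 ^ 6 * J q 4 / (J q 1 ^ 4 * J q 8 ^ 2)))
     \<and> (\<lambda>n. of_nat (N0 1 2 (4 * n)) * q ^ n) sums
        (- 1 + mock_g (- 1) (q ^ 2) + 1 / 2 * (J q 2 ^ 15 / (J q 1 ^ 8 * J q 4 ^ 6)))
     \<and> (\<lambda>n. of_nat (N0 1 2 (4 * n + 2)) * q ^ n) sums
        (2 * (J q 2 ^ 3 * J q 4 ^ 2 / J q 1 ^ 4))
     \<and> (\<lambda>n. of_nat (N0 0 2 (8 * n + 1)) * q ^ n) sums
        (J q 2 ^ 12 * J q 4 / (J q 1 ^ 10 * J q 8 ^ 2)
          + 8 * q * (J q 2 ^ 2 * J q 4 ^ 3 * J q 8 ^ 2 / J q 1 ^ 6))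
     \<and> (q \<noteq> 0 \<longrightarrow> (\<lambda>n. of_nat (N0 0 2 (8 * n + 3)) * q ^ n) sums
        (q * mock_g (- (q ^ 2)) (q ^ 4) - J q 2 ^ 8 * J q 8 ^ 2 / (J q 1 ^ 4 * J q 4 ^ 5)
          + 4 * (J q 2 ^ 6 * J q 4 ^ 5 / (J q 1 ^ 8 * J q 8 ^ 2))))
     \<and> (\<lambda>n. of_nat (N0 0 2 (8 * n + 5)) * q ^ n) sums
        (2 * (J q 2 ^ 14 * J q 8 ^ 2 / (J q 1 ^ 10 * J q 4 ^ 5)
          + 2 * (J q 4 ^ 9 / (J q 1 ^ 6 * J q 8 ^ 2))))
     \<and> (q \<noteq> 0 \<longrightarrow> (\<lambda>n. of_nat (N0 0 2 (8 * n + 7)) * q ^ n) sums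
        (- inverse q + inverse q * mock_g (- 1) (q ^ 4)
          + 1 / 2 * inverse q * (J q 2 ^ 6 * J q 4 / (J q 1 ^ 4 * J q 8 ^ 2))
          + 8 * (J q 2 ^ 8 * J q 8 ^ 2 / (J q 1 ^ 8 * J q 4))))
     \<and> (\<lambda>n. of_nat (N0 1 2 (8 * n)) * q ^ n) sums
        (- 1 + mock_g (- 1) q + 1 / 2 * (J q 2 ^ 22 / (J q 1 ^ 13 * J q 4 ^ 8))
          + 8 * q * (J q 4 ^ 8 / (J q 1 ^ 5 * J q 2 ^ 2)))
     \<and> (\<lambda>n. of_nat (N0 1 2 (8 * n + 2)) * q ^ n) sums
        (2 * (J q 2 ^ 16 / (J q 1 ^ 11 * J q 4 ^ 4)))
     \<and> (\<lambda>n. of_nat (N0 1 2 (8 * n + 4)) * q ^ n) sums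
        (4 * (J q 2 ^ 10 / J q 1 ^ 9))
     \<and> (\<lambda>n. of_nat (N0 1 2 (8 * n + 6)) * q ^ n) sums
        (8 * (J q 2 ^ 4 * J q 4 ^ 4 / J q 1 ^ 7))"
proof (cases "q = 0")
  case False
  note q = assms False
  show ?thesis
    using gf_odd[OF q] gf_even[OF q] gf_4n_and_4n_plus_2[OF q] gf_4n_plus_1_and_4n_plus_3[OF q]
      gf_8n_plus_1_and_8n_plus_5[OF q] gf_8n_plus_3_and_8n_plus_7[OF q] gf_8n_and_8n_plus_4[OF q]
      gf_8n_plus_2_and_8n_plus_6[OF q]
    unfolding durfee_even_def durfee_odd_def
    by (simp add: algebra_simps)
next
  case True
  \<comment> \<open>The three unconditional series with a mock term are checked directly, which
    avoids continuity of \<open>mock_g\<close> in its base. Their constant coefficient is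
    \<open>N0 1 2 0 = 0\<close>, and the closed forms reduce to -1 + 1/2 + 1/2.\<close>
  have zero: "(\<lambda>n. of_nat (N0 1 2 (k * n)) * 0 ^ n :: complex) sums 0" for k
    using powser_sums_zero[of "\<lambda>n. of_nat (N0 1 2 (k * n)) :: complex"] by (simp add: N0_zero)
  have cont: "isCont (\<lambda>q. J q m) 0" "J 0 m \<noteq> 0" if "m > 0" for m
    using that by (simp_all add: isCont_J_zero)
  show ?thesis
    using sums_at_zero[OF gf_4n_plus_1_and_4n_plus_3(1)] sums_at_zero[OF gf_4n_and_4n_plus_2(2)]
      sums_at_zero[OF gf_8n_plus_1_and_8n_plus_5(1)] sums_at_zero[OF gf_8n_plus_1_and_8n_plus_5(2)]
      sums_at_zero[OF gf_8n_plus_2_and_8n_plus_6(1)] sums_at_zero[OF gf_8n_plus_2_and_8n_plus_6(2)]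
      sums_at_zero[OF gf_8n_and_8n_plus_4(2)] zero[of 2] zero[of 4] zero[of 8]
    unfolding True
    by (simp add: mock_g_neg_1_0 cont)
qed

end
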